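(* Let $\Omega\subset\mathbb{R}^m$ be a convex domain, let $F=[f^0:f^1:\dots:f^k]$ and $\tilde F=[\tilde f^0:\tilde f^1:\dots:\tilde f^k]$ be holomorphic almost periodic mappings from $T_\Omega$ to $\mathbb{CP}^k$, and let $h$ be holomorphic on $T_\Omega$. Suppose the functions $f^l\tilde f^l/h$, $l=0,\dots,k$, are holomorphic on $T_\Omega$ and their divisors satisfy: for each $\Omega'\Subset\Omega$ there is $\delta>0$ such that every ball $B(z_0,\delta)$, $z_0\in T_{\Omega'}$, intersects at most $k$ of the supports of these divisors. Then $f^0\tilde f^0/h,\dots,f^k\tilde f^k/h$ are homogeneous coordinates of some holomorphic almost periodic mapping $T_\Omega\to\mathbb{CP}^k$.
   Context: $T_\Omega=\{x+iy:x\in\mathbb{R}^m,y\in\Omega\}$; $S_t$ is translation by $t\in\mathbb{R}^m$. A holomorphic map $T_\Omega\to\mathbb{CP}^k$ is written in homogeneous coordinates $[f^0:\dots:f^k]$ with $f^l$ holomorphic on $T_\Omega$, without common zeros and none identically zero (unique up to a common nonvanishing holomorphic factor). It is almost periodic if $\{S_tF\}_{t\in\mathbb{R}^m}$ is relatively compact in the topology of uniform convergence (Fubini–Study metric) on every $T_{\Omega'}$, $\Omega'\Subset\Omega$. *)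

theory Defs
  imports "HOL-Analysis.Analysis"
begin

definition im_part :: "complex ^ 'm \<Rightarrow> real ^ 'm" where
  "im_part z = (\<chi> j. Im (z $ j))"

definition real_to_complex :: "real ^ 'm \<Rightarrow> complex ^ 'm" where
  "real_to_complex t = (\<chi> j. complex_of_real (t $ j))"

definition tube :: "(real ^ 'm) set \<Rightarrow> (complex ^ 'm) set" where
  "tube \<Omega> = {z. im_part z \<in> \<Omega>}"

definition hol_on :: "(complex ^ 'm) set \<Rightarrow> (complex ^ 'm \<Rightarrow> complex) \<Rightarrow> bool" where
  "hol_on S f \<longleftrightarrow> (\<forall>z\<in>S. \<exists>L. (f has_derivative L) (at z) \<and>
                       (\<forall>c v. L (c *s v) = c * L v))"

definition compactly_in :: "(real ^ 'm) set \<Rightarrow> (real ^ 'm) set \<Rightarrow> bool" where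
  "compactly_in A B \<longleftrightarrow> bounded A \<and> closure A \<subseteq> B"

definition domain :: "(real ^ 'm) set \<Rightarrow> bool" where
  "domain \<Omega> \<longleftrightarrow> open \<Omega> \<and> connected \<Omega> \<and> \<Omega> \<noteq> {}"

text \<open>Fubini--Study distance between the points [a], [b] of CP^k given by nonzero
  vectors a, b (indexed by 0..k).\<close>
definition fs_dist :: "nat \<Rightarrow> (nat \<Rightarrow> complex) \<Rightarrow> (nat \<Rightarrow> complex) \<Rightarrow> real" where
  "fs_dist k a b = arccos (cmod (\<Sum>l\<le>k. a l * cnj (b l)) /
      (sqrt (\<Sum>l\<le>k. (cmod (a l))\<^sup>2) * sqrt (\<Sum>l\<le>k. (cmod (b l))\<^sup>2)))"

definition hol_map_CP :: "(real ^ 'm) set \<Rightarrow> nat \<Rightarrow> (nat \<Rightarrow> complex ^ 'm \<Rightarrow> complex) \<Rightarrow> bool" where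
  "hol_map_CP \<Omega> k f \<longleftrightarrow>
     (\<forall>l\<le>k. hol_on (tube \<Omega>) (f l) \<and> (\<exists>z\<in>tube \<Omega>. f l z \<noteq> 0)) \<and>
     (\<forall>z\<in>tube \<Omega>. \<exists>l\<le>k. f l z \<noteq> 0)"

text \<open>Almost periodicity: the family of translates S_t F (t real) is relatively compact
  in the topology of uniform convergence (Fubini--Study metric) on every T_Omega',
  Omega' compactly contained in Omega: every sequence of translates has a subsequence
  converging uniformly on every such T_Omega' to some map G into CP^k.\<close>
definition almost_periodic_CP ::
  "(real ^ 'm) set \<Rightarrow> nat \<Rightarrow> (nat \<Rightarrow> complex ^ 'm \<Rightarrow> complex) \<Rightarrow> bool" where
  "almost_periodic_CP \<Omega> k f \<longleftrightarrow> hol_map_CP \<Omega> k f \<and>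
     (\<forall>t :: nat \<Rightarrow> real ^ 'm. \<exists>(r :: nat \<Rightarrow> nat) (G :: complex ^ 'm \<Rightarrow> nat \<Rightarrow> complex). strict_mono r \<and>
        (\<forall>z\<in>tube \<Omega>. \<exists>l\<le>k. G z l \<noteq> 0) \<and>
        (\<forall>\<Omega>' :: (real ^ 'm) set. compactly_in \<Omega>' \<Omega> \<longrightarrow>
           (\<forall>\<epsilon>>0. \<exists>N. \<forall>n\<ge>N. \<forall>z\<in>tube \<Omega>'.
              fs_dist k (\<lambda>l. f l (z + real_to_complex (t (r n)))) (G z) < \<epsilon>)))"

end

(* Represent a point [a] of CP^k by the rank-one projector with entries a_i cnj(a_l) / |a|^2; uniform
   Fubini-Study convergence is uniform convergence of these entries, and the distance between two
   points is also measured by the wedge a_i b_l - a_l b_i over |a| |b|. For two translates of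
   g = f f' / h the wedge, divided by a component of each translate without zeros near the given
   point, is holomorphic on a disc, so by the maximum principle it suffices to bound it on the
   boundary circle. There it is controlled by the wedges of the translates of f and f', provided
   no component of f or f' comes close to vanishing on the circle; h cancels. A compactness
   argument together with the identity theorem on complex lines yields such circles around all
   points of a tube with a common lower bound. *)
theory Submission
  imports Defs "HOL-Complex_Analysis.Complex_Analysis"
begin

section \<open>Rank-one projectors and the Fubini--Study distance\<close>

text \<open>Homogeneous coordinates of a translate are fixed only up to a nonvanishing factor, so
  convergence of translates says nothing about the coordinates themselves. Projector entries ignore
  the factor but are not holomorphic; wedges are holomorphic but carry it. Hence hypotheses and
  conclusion are expressed by entries, while the maximum principle is applied to normalised wedges.
  A ratio \<open>g i / g p\<close> would not serve, since the index of a zero-free component changes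
  with the point and the translate; a wedge can be divided by components of different index in its
  two arguments. The divisor hypothesis supplies these indices: at most k of the k+1 divisors meet a
  small ball. Inside the disc the zeros of the components of \<open>f\<close> and \<open>f'\<close>
  and of \<open>h\<close> are out of control, hence the detour over the circle. No limit of the
  translates of \<open>g\<close> is guessed: they are shown to be uniformly Cauchy, and completeness
  of projective space yields the limit. Convexity makes each complex line meet the tube in a
  connected set, so that nonvanishing of a limit component at one point spreads along the line up to
  isolated zeros.\<close>

definition sqnorm :: "nat \<Rightarrow> (nat \<Rightarrow> complex) \<Rightarrow> real" where
  "sqnorm k a = (\<Sum>j\<le>k. (cmod (a j))\<^sup>2)"

definition proj_entry :: "nat \<Rightarrow> (nat \<Rightarrow> complex) \<Rightarrow> nat \<Rightarrow> nat \<Rightarrow> complex" where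
  "proj_entry k a i l = a i * cnj (a l) / complex_of_real (sqnorm k a)"

definition fs_cos :: "nat \<Rightarrow> (nat \<Rightarrow> complex) \<Rightarrow> (nat \<Rightarrow> complex) \<Rightarrow> real" where
  "fs_cos k a b = cmod (\<Sum>l\<le>k. a l * cnj (b l)) / (sqrt (sqnorm k a) * sqrt (sqnorm k b))"

lemma fs_dist_eq_arccos: "fs_dist k a b = arccos (fs_cos k a b)"
  by (simp add: fs_dist_def fs_cos_def sqnorm_def)

lemma sqnorm_pos: "\<exists>l\<le>k. a l \<noteq> 0 \<Longrightarrow> 0 < sqnorm k a"
  unfolding sqnorm_def by (auto intro: sum_pos2)

lemma cmod_sq_le_sqnorm: "l \<le> k \<Longrightarrow> (cmod (a l))\<^sup>2 \<le> sqnorm k a"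
  unfolding sqnorm_def by (rule member_le_sum) auto

lemma cmod_le_sqrt_sqnorm: "l \<le> k \<Longrightarrow> cmod (a l) \<le> sqrt (sqnorm k a)"
  using cmod_sq_le_sqnorm real_le_rsqrt by blast

lemma complex_sqnorm: "complex_of_real (sqnorm k a) = (\<Sum>j\<le>k. a j * cnj (a j))"
  by (simp only: sqnorm_def of_real_sum complex_norm_square)

text \<open>This is \<open>|<a,b>|^2\<close> expanded. Both sums of squares computed below contain
  this double sum as their cross term, which is how each is expressed by
  \<open>fs_cos\<close>.\<close>

lemma fs_cos_sq:
  assumes "0 < sqnorm k a" "0 < sqnorm k b"
  shows "complex_of_real ((fs_cos k a b)\<^sup>2 * sqnorm k a * sqnorm k b) =
    (\<Sum>i\<le>k. \<Sum>l\<le>k. a i * b l * cnj (a l) * cnj (b i))"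
proof -
  have "(fs_cos k a b)\<^sup>2 * sqnorm k a * sqnorm k b = (cmod (\<Sum>l\<le>k. a l * cnj (b l)))\<^sup>2"
    using assms by (simp add: fs_cos_def power_divide power_mult_distrib)
  then have "complex_of_real ((fs_cos k a b)\<^sup>2 * sqnorm k a * sqnorm k b) =
      (\<Sum>l\<le>k. a l * cnj (b l)) * cnj (\<Sum>l\<le>k. a l * cnj (b l))"
    by (simp only: complex_norm_square)
  also have "\<dots> = (\<Sum>i\<le>k. \<Sum>l\<le>k. a i * b l * cnj (a l) * cnj (b i))"
    by (simp add: sum_product mult_ac)
  finally show ?thesis .
qed

text \<open>Lagrange's identity: \<open>|a|^2 |b|^2 - |<a,b>|^2\<close> is the sum over unordered
  pairs, and here each pair is counted twice.\<close>

lemma sum_wedge_sq: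
  assumes "0 < sqnorm k a" "0 < sqnorm k b"
  shows "(\<Sum>i\<le>k. \<Sum>l\<le>k. (cmod (a i * b l - a l * b i))\<^sup>2) =
    (2 - 2 * (fs_cos k a b)\<^sup>2) * sqnorm k a * sqnorm k b"
proof -
  let ?T = "\<Sum>i\<le>k. \<Sum>l\<le>k. a i * b l * cnj (a l) * cnj (b i)"
  let ?N = "\<Sum>i\<le>k. \<Sum>l\<le>k. a i * cnj (a i) * (b l * cnj (b l))"
  have N: "?N = complex_of_real (sqnorm k a * sqnorm k b)"
    by (simp add: complex_sqnorm sum_product)
  have T: "?T = complex_of_real ((fs_cos k a b)\<^sup>2 * sqnorm k a * sqnorm k b)"
    using fs_cos_sq[OF assms] by simp
  have T': "(\<Sum>i\<le>k. \<Sum>l\<le>k. a l * b i * cnj (a i) * cnj (b l)) = ?T"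
    by (rule sum.swap)
  have N': "(\<Sum>i\<le>k. \<Sum>l\<le>k. a l * cnj (a l) * (b i * cnj (b i))) = ?N"
    by (rule sum.swap)
  have "complex_of_real (\<Sum>i\<le>k. \<Sum>l\<le>k. (cmod (a i * b l - a l * b i))\<^sup>2) =
      (\<Sum>i\<le>k. \<Sum>l\<le>k. (a i * b l - a l * b i) * cnj (a i * b l - a l * b i))"
    by (simp only: of_real_sum complex_norm_square)
  also have "\<dots> = (\<Sum>i\<le>k. \<Sum>l\<le>k. a i * cnj (a i) * (b l * cnj (b l)) + a l * cnj (a l) * (b i * cnj (b i))
      - a i * b l * cnj (a l) * cnj (b i) - a l * b i * cnj (a i) * cnj (b l))"
    by (intro sum.cong refl) (simp add: algebra_simps)
  also have "\<dots> = ?N + ?N - ?T - ?T"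
    by (simp only: sum_subtractf sum.distrib T' N')
  also have "\<dots> = complex_of_real ((2 - 2 * (fs_cos k a b)\<^sup>2) * sqnorm k a * sqnorm k b)"
    unfolding N T by (simp add: algebra_simps)
  finally show ?thesis
    by (simp only: of_real_eq_iff)
qed

text \<open>Squared Hilbert-Schmidt distance of two rank-one projectors \<open>P\<close>,
  \<open>Q\<close>: each contributes trace 1, and the cross terms give \<open>-2 tr(P Q)\<close>.
  Compared with the preceding identity, wedges and entry differences measure the same quantity up to
  the norms of \<open>a\<close> and \<open>b\<close>.\<close>

lemma sum_proj_entry_diff_sq:
  assumes "0 < sqnorm k a" "0 < sqnorm k b"
  shows "(\<Sum>i\<le>k. \<Sum>l\<le>k. (cmod (proj_entry k a i l - proj_entry k b i l))\<^sup>2) =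
    2 - 2 * (fs_cos k a b)\<^sup>2"
proof -
  define A where "A = complex_of_real (sqnorm k a)"
  define B where "B = complex_of_real (sqnorm k b)"
  have nz: "A \<noteq> 0" "B \<noteq> 0" and cA: "cnj A = A" "cnj B = B"
    using assms by (auto simp: A_def B_def)
  let ?T = "\<Sum>i\<le>k. \<Sum>l\<le>k. a i * b l * cnj (a l) * cnj (b i)"
  have T: "?T = complex_of_real ((fs_cos k a b)\<^sup>2) * A * B"
    using fs_cos_sq[OF assms] by (simp add: A_def B_def)
  have T': "(\<Sum>i\<le>k. \<Sum>l\<le>k. a l * b i * cnj (a i) * cnj (b l)) = ?T"
    by (rule sum.swap)
  have AA: "(\<Sum>i\<le>k. \<Sum>l\<le>k. a i * cnj (a i) * (a l * cnj (a l))) = A * A"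
    "(\<Sum>i\<le>k. \<Sum>l\<le>k. b i * cnj (b i) * (b l * cnj (b l))) = B * B"
    by (simp_all add: A_def B_def complex_sqnorm sum_product)
  have "complex_of_real (\<Sum>i\<le>k. \<Sum>l\<le>k. (cmod (proj_entry k a i l - proj_entry k b i l))\<^sup>2) =
      (\<Sum>i\<le>k. \<Sum>l\<le>k. (proj_entry k a i l - proj_entry k b i l) * cnj (proj_entry k a i l - proj_entry k b i l))"
    by (simp only: of_real_sum complex_norm_square)
  also have "\<dots> = (\<Sum>i\<le>k. \<Sum>l\<le>k. a i * cnj (a i) * (a l * cnj (a l)) / (A * A)
      + b i * cnj (b i) * (b l * cnj (b l)) / (B * B)
      - a i * b l * cnj (a l) * cnj (b i) / (A * B) - a l * b i * cnj (a i) * cnj (b l) / (A * B))"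
    unfolding proj_entry_def A_def[symmetric] B_def[symmetric]
    using nz by (intro sum.cong refl) (simp add: cA field_simps)
  also have "\<dots> = A * A / (A * A) + B * B / (B * B) - ?T / (A * B) - ?T / (A * B)"
    by (simp only: sum_subtractf sum.distrib T' AA sum_divide_distrib[symmetric])
  also have "\<dots> = complex_of_real (2 - 2 * (fs_cos k a b)\<^sup>2)"
    unfolding T using nz by simp
  finally show ?thesis
    by (simp only: of_real_eq_iff)
qed

text \<open>Cauchy-Schwarz, read off from the nonnegativity of a sum of squares.\<close>

lemma fs_cos_bounds:
  assumes "0 < sqnorm k a" "0 < sqnorm k b"
  shows "0 \<le> fs_cos k a b" "fs_cos k a b \<le> 1"
proof -
  show "0 \<le> fs_cos k a b"
    using assms by (simp add: fs_cos_def)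
  have "0 \<le> 2 - 2 * (fs_cos k a b)\<^sup>2"
    unfolding sum_proj_entry_diff_sq[OF assms, symmetric] by (intro sum_nonneg) auto
  then show "fs_cos k a b \<le> 1"
    by (simp add: power_le_one_iff abs_square_le_1)
qed

lemma double_sum_member_le:
  fixes F :: "nat \<Rightarrow> nat \<Rightarrow> real"
  assumes "i \<le> k" "l \<le> k" and "\<And>i l. 0 \<le> F i l"
  shows "F i l \<le> (\<Sum>i\<le>k. \<Sum>l\<le>k. F i l)"
proof -
  have "F i l \<le> (\<Sum>l\<le>k. F i l)"
    using assms by (intro member_le_sum) auto
  also have "\<dots> \<le> (\<Sum>i\<le>k. \<Sum>l\<le>k. F i l)"
    using assms by (intro member_le_sum[where f = "\<lambda>i. \<Sum>l\<le>k. F i l"]) (auto intro: sum_nonneg)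
  finally show ?thesis .
qed

lemma double_sum_le:
  fixes F :: "nat \<Rightarrow> nat \<Rightarrow> real"
  assumes "\<And>i l. i \<le> k \<Longrightarrow> l \<le> k \<Longrightarrow> F i l \<le> M"
  shows "(\<Sum>i\<le>k. \<Sum>l\<le>k. F i l) \<le> (real (Suc k))\<^sup>2 * M"
proof -
  have "(\<Sum>i\<le>k. \<Sum>l\<le>k. F i l) \<le> (\<Sum>i\<le>k. \<Sum>l\<le>k. M)"
    using assms by (intro sum_mono) auto
  then show ?thesis
    by (simp add: power2_eq_square mult.assoc)
qed

text \<open>Both double sums are multiples of \<open>1 - cos^2\<close>, so a bound on all
  \<open>(k+1)^2\<close> entries passes to the sum of wedges and from there to a single wedge; the
  root of the number of entries is the factor \<open>Suc k\<close>.\<close>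

lemma wedge_le_of_proj_entry:
  assumes "0 < sqnorm k a" "0 < sqnorm k b" and "0 \<le> \<eta>"
    and close: "\<And>i l. i \<le> k \<Longrightarrow> l \<le> k \<Longrightarrow> cmod (proj_entry k a i l - proj_entry k b i l) \<le> \<eta>"
    and "i \<le> k" "l \<le> k"
  shows "cmod (a i * b l - a l * b i) \<le> real (Suc k) * \<eta> * sqrt (sqnorm k a) * sqrt (sqnorm k b)"
proof -
  have "2 - 2 * (fs_cos k a b)\<^sup>2 \<le> (real (Suc k))\<^sup>2 * \<eta>\<^sup>2"
    unfolding sum_proj_entry_diff_sq[OF assms(1,2), symmetric]
    by (intro double_sum_le power_mono close) auto
  moreover have "(cmod (a i * b l - a l * b i))\<^sup>2 \<le> (2 - 2 * (fs_cos k a b)\<^sup>2) * sqnorm k a * sqnorm k b"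
    unfolding sum_wedge_sq[OF assms(1,2), symmetric]
    using assms by (intro double_sum_member_le) auto
  ultimately have "(cmod (a i * b l - a l * b i))\<^sup>2 \<le> (real (Suc k))\<^sup>2 * \<eta>\<^sup>2 * sqnorm k a * sqnorm k b"
    by (smt (verit, best) assms(1,2) mult_right_mono)
  also have "\<dots> = (real (Suc k) * \<eta> * sqrt (sqnorm k a) * sqrt (sqnorm k b))\<^sup>2"
    using assms by (simp add: power_mult_distrib)
  finally show ?thesis
    using assms by (intro power2_le_imp_le[of "cmod _"]) auto
qed

lemma proj_entry_le_of_wedge:
  assumes "0 < sqnorm k a" "0 < sqnorm k b" and "0 \<le> \<eta>"
    and close: "\<And>i l. i \<le> k \<Longrightarrow> l \<le> k \<Longrightarrow>
      cmod (a i * b l - a l * b i) \<le> \<eta> * sqrt (sqnorm k a) * sqrt (sqnorm k b)"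
    and "i \<le> k" "l \<le> k"
  shows "cmod (proj_entry k a i l - proj_entry k b i l) \<le> real (Suc k) * \<eta>"
proof -
  have "(2 - 2 * (fs_cos k a b)\<^sup>2) * sqnorm k a * sqnorm k b \<le>
      (real (Suc k))\<^sup>2 * (\<eta> * sqrt (sqnorm k a) * sqrt (sqnorm k b))\<^sup>2"
    unfolding sum_wedge_sq[OF assms(1,2), symmetric]
    by (intro double_sum_le power_mono close) auto
  also have "\<dots> = ((real (Suc k))\<^sup>2 * \<eta>\<^sup>2) * (sqnorm k a * sqnorm k b)"
    using assms by (simp add: power_mult_distrib)
  finally have "2 - 2 * (fs_cos k a b)\<^sup>2 \<le> (real (Suc k))\<^sup>2 * \<eta>\<^sup>2"
    using assms(1,2) by (simp add: mult.assoc)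
  moreover have "(cmod (proj_entry k a i l - proj_entry k b i l))\<^sup>2 \<le> 2 - 2 * (fs_cos k a b)\<^sup>2"
    unfolding sum_proj_entry_diff_sq[OF assms(1,2), symmetric]
    using assms by (intro double_sum_member_le) auto
  ultimately have "(cmod (proj_entry k a i l - proj_entry k b i l))\<^sup>2 \<le> (real (Suc k) * \<eta>)\<^sup>2"
    by (simp only: power_mult_distrib)
  then show ?thesis
    using assms by (intro power2_le_imp_le[of "cmod _"]) auto
qed

text \<open>With \<open>d\<close> the Fubini-Study distance, an entry differs by at most
  \<open>sqrt 2 * sin d\<close>, and \<open>sin d \<le> d\<close>; the factor 2 is a crude
  \<open>sqrt 2\<close>.\<close>

lemma proj_entry_le_of_fs_dist:
  assumes "0 < sqnorm k a" "0 < sqnorm k b" "i \<le> k" "l \<le> k"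
  shows "cmod (proj_entry k a i l - proj_entry k b i l) \<le> 2 * fs_dist k a b"
proof -
  let ?c = "fs_cos k a b" and ?d = "fs_dist k a b"
  have c: "0 \<le> ?c" "?c \<le> 1"
    using fs_cos_bounds assms by auto
  then have d: "0 \<le> ?d" "cos ?d = ?c"
    by (auto simp: fs_dist_eq_arccos arccos_lbound cos_arccos)
  have "(cmod (proj_entry k a i l - proj_entry k b i l))\<^sup>2 \<le> 2 - 2 * ?c\<^sup>2"
    unfolding sum_proj_entry_diff_sq[OF assms(1,2), symmetric]
    using assms by (intro double_sum_member_le) auto
  also have "\<dots> = 2 * (sin ?d)\<^sup>2"
    using sin_cos_squared_add[of ?d] d by simp
  also have "\<dots> \<le> 2 * ?d\<^sup>2"
    using abs_sin_x_le_abs_x[of ?d] by (simp add: abs_le_square_iff)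
  also have "\<dots> \<le> (2 * ?d)\<^sup>2"
    by (simp add: power_mult_distrib)
  finally show ?thesis
    using d by (intro power2_le_imp_le[of "cmod _"]) auto
qed

lemma fs_dist_less_of_proj_entry:
  assumes "0 < (\<epsilon>::real)"
  obtains \<eta> where "0 < \<eta>"
    "\<And>a b. \<lbrakk>0 < sqnorm k a; 0 < sqnorm k b;
      \<And>i l. \<lbrakk>i \<le> k; l \<le> k\<rbrakk> \<Longrightarrow> cmod (proj_entry k a i l - proj_entry k b i l) < \<eta>\<rbrakk>
      \<Longrightarrow> fs_dist k a b < \<epsilon>"
proof -
  \<comment> \<open>Capping at 1 keeps \<open>e\<close> inside \<open>(0, pi)\<close>, where the
    sine is positive and the cosine decreases.\<close>
  define e where "e = min \<epsilon> 1"
  have e: "0 < e" "e \<le> 1" "e \<le> \<epsilon>"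
    using assms by (auto simp: e_def)
  then have sin: "0 < sin e"
    using pi_gt3 by (intro sin_gt_zero) auto
  \<comment> \<open>Chosen so that the \<open>(k+1)^2\<close> squared entries sum to at most
    \<open>sin^2 e\<close>, half of the \<open>2 sin^2 e\<close> that a distance of at least
    \<open>e\<close> would force.\<close>
  define \<eta> where "\<eta> = sin e / real (Suc k)"
  have "0 < \<eta>"
    using sin by (simp add: \<eta>_def)
  moreover have "fs_dist k a b < \<epsilon>"
    if ab: "0 < sqnorm k a" "0 < sqnorm k b"
      and close: "\<And>i l. \<lbrakk>i \<le> k; l \<le> k\<rbrakk> \<Longrightarrow> cmod (proj_entry k a i l - proj_entry k b i l) < \<eta>" for a b
  proof (rule ccontr)
    assume "\<not> fs_dist k a b < \<epsilon>"
    then have le: "e \<le> fs_dist k a b"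
      using e by simp
    let ?c = "fs_cos k a b"
    have c: "0 \<le> ?c" "?c \<le> 1"
      using fs_cos_bounds ab by auto
    then have d: "fs_dist k a b \<le> pi" "cos (fs_dist k a b) = ?c"
      by (auto simp: fs_dist_eq_arccos arccos_ubound cos_arccos)
    have "?c \<le> cos e"
      using cos_monotone_0_pi_le[of e "fs_dist k a b"] le d e by simp
    then have "?c\<^sup>2 \<le> (cos e)\<^sup>2"
      using c by (intro power_mono)
    then have "2 * (sin e)\<^sup>2 \<le> 2 - 2 * ?c\<^sup>2"
      using sin_cos_squared_add[of e] by linarith
    also have "\<dots> \<le> (real (Suc k))\<^sup>2 * \<eta>\<^sup>2"
      unfolding sum_proj_entry_diff_sq[OF ab, symmetric]
      using close[THEN less_imp_le] by (intro double_sum_le power_mono) auto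
    also have "\<dots> = (sin e)\<^sup>2"
      by (simp add: \<eta>_def power_divide)
    finally show False
      using sin by simp
  qed
  ultimately show thesis
    by (rule that)
qed

section \<open>Convergence of maps into projective space\<close>

text \<open>Convergence is uniform on tubes over relatively compact bases, which are unbounded in
  the real directions. \<open>G\<close> is an arbitrary choice of nonzero representatives; only the
  projectors of its values enter.\<close>

definition CP_limit :: "(real ^ 'm) set \<Rightarrow> nat \<Rightarrow> (nat \<Rightarrow> nat \<Rightarrow> complex ^ 'm \<Rightarrow> complex) \<Rightarrow>
    (complex ^ 'm \<Rightarrow> nat \<Rightarrow> complex) \<Rightarrow> bool" where
  "CP_limit \<Omega> k F G \<longleftrightarrow> (\<forall>z\<in>tube \<Omega>. \<exists>l\<le>k. G z l \<noteq> 0) \<and>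
    (\<forall>\<Omega>'. compactly_in \<Omega>' \<Omega> \<longrightarrow> (\<forall>i\<le>k. \<forall>l\<le>k.
      uniform_limit (tube \<Omega>') (\<lambda>n z. proj_entry k (\<lambda>l. F n l z) i l)
        (\<lambda>z. proj_entry k (G z) i l) sequentially))"

lemma im_part_add_real [simp]: "im_part (z + real_to_complex t) = im_part z"
  by (simp add: im_part_def real_to_complex_def)

lemma tube_translate [simp]: "z + real_to_complex t \<in> tube \<Omega> \<longleftrightarrow> z \<in> tube \<Omega>"
  by (simp add: tube_def)

lemma tube_mono: "A \<subseteq> B \<Longrightarrow> tube A \<subseteq> tube B"
  by (auto simp: tube_def)

lemma compactly_in_subset: "compactly_in A B \<Longrightarrow> A \<subseteq> B"
  unfolding compactly_in_def using closure_subset by blast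

lemma hol_map_CP_sqnorm_pos:
  "hol_map_CP \<Omega> k f \<Longrightarrow> z \<in> tube \<Omega> \<Longrightarrow> 0 < sqnorm k (\<lambda>l. f l z)"
  unfolding hol_map_CP_def by (intro sqnorm_pos) auto

lemma fs_dist_uniform_iff:
  assumes a: "\<And>n z. z \<in> S \<Longrightarrow> 0 < sqnorm k (a n z)" and b: "\<And>z. z \<in> S \<Longrightarrow> 0 < sqnorm k (b z)"
  shows "(\<forall>\<epsilon>>0. \<exists>N. \<forall>n\<ge>N. \<forall>z\<in>S. fs_dist k (a n z) (b z) < \<epsilon>) \<longleftrightarrow>
    (\<forall>i\<le>k. \<forall>l\<le>k. uniform_limit S (\<lambda>n z. proj_entry k (a n z) i l)
      (\<lambda>z. proj_entry k (b z) i l) sequentially)" (is "?L \<longleftrightarrow> ?R")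
proof
  assume L: ?L
  show ?R
  proof (intro allI impI uniform_limitI)
    fix i l and e :: real assume il: "i \<le> k" "l \<le> k" and "0 < e"
    then obtain N where N: "\<And>n z. n \<ge> N \<Longrightarrow> z \<in> S \<Longrightarrow> fs_dist k (a n z) (b z) < e / 2"
      using L[rule_format, of "e/2"] by auto
    show "\<forall>\<^sub>F n in sequentially. \<forall>z\<in>S. dist (proj_entry k (a n z) i l) (proj_entry k (b z) i l) < e"
      unfolding eventually_sequentially
    proof (intro exI allI impI ballI)
      fix n z assume "n \<ge> N" "z \<in> S"
      then show "dist (proj_entry k (a n z) i l) (proj_entry k (b z) i l) < e"
        using N[of n z] proj_entry_le_of_fs_dist[OF a b il, of z z n] by (simp add: dist_norm)
    qed
  qed
next
  assume R: ?R
  show ?L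
  proof (intro allI impI)
    fix \<epsilon> :: real assume "0 < \<epsilon>"
    then obtain \<eta> where \<eta>: "0 < \<eta>" and close: "\<And>a b. \<lbrakk>0 < sqnorm k a; 0 < sqnorm k b;
      \<And>i l. \<lbrakk>i \<le> k; l \<le> k\<rbrakk> \<Longrightarrow> cmod (proj_entry k a i l - proj_entry k b i l) < \<eta>\<rbrakk>
      \<Longrightarrow> fs_dist k a b < \<epsilon>"
      using fs_dist_less_of_proj_entry[where k = k] by blast
    have "\<forall>\<^sub>F n in sequentially. \<forall>i\<in>{..k}. \<forall>l\<in>{..k}. \<forall>z\<in>S.
        dist (proj_entry k (a n z) i l) (proj_entry k (b z) i l) < \<eta>"
      using R \<eta> by (intro eventually_ball_finite[OF finite_atMost] ballI) (auto simp: uniform_limit_iff)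
    then obtain N where "\<forall>n\<ge>N. \<forall>i\<in>{..k}. \<forall>l\<in>{..k}. \<forall>z\<in>S.
        dist (proj_entry k (a n z) i l) (proj_entry k (b z) i l) < \<eta>"
      unfolding eventually_sequentially by blast
    then show "\<exists>N. \<forall>n\<ge>N. \<forall>z\<in>S. fs_dist k (a n z) (b z) < \<epsilon>"
      by (intro exI[of _ N] allI impI ballI close a b) (auto simp: dist_norm)
  qed
qed

text \<open>Trades the Fubini-Study metric for uniform limits of complex-valued functions;
  everything that follows is phrased with projector entries.\<close>

lemma almost_periodic_CP_iff:
  fixes \<Omega> :: "(real ^ 'm) set"
  shows
  "almost_periodic_CP \<Omega> k f \<longleftrightarrow> hol_map_CP \<Omega> k f \<and>
    (\<forall>t :: nat \<Rightarrow> real ^ 'm. \<exists>r G. strict_mono r \<and> CP_limit \<Omega> k (\<lambda>n l z. f l (z + real_to_complex (t (r n)))) G)"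
proof -
  have key: "(\<forall>\<epsilon>>0. \<exists>N. \<forall>n\<ge>N. \<forall>z\<in>tube \<Omega>'.
          fs_dist k (\<lambda>l. f l (z + real_to_complex (t (r n)))) (G z) < \<epsilon>) \<longleftrightarrow>
      (\<forall>i\<le>k. \<forall>l\<le>k. uniform_limit (tube \<Omega>')
        (\<lambda>n z. proj_entry k (\<lambda>l. f l (z + real_to_complex (t (r n)))) i l)
        (\<lambda>z. proj_entry k (G z) i l) sequentially)"
    if "hol_map_CP \<Omega> k f" "\<forall>z\<in>tube \<Omega>. \<exists>l\<le>k. G z l \<noteq> 0" "compactly_in \<Omega>' \<Omega>"
    for t :: "nat \<Rightarrow> real ^ 'm" and r :: "nat \<Rightarrow> nat" and G and \<Omega>'
  proof (rule fs_dist_uniform_iff)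
    fix z assume "z \<in> tube \<Omega>'"
    then have z: "z \<in> tube \<Omega>"
      using that(3) compactly_in_subset tube_mono by blast
    then show "0 < sqnorm k (G z)"
      using that by (intro sqnorm_pos) auto
    show "0 < sqnorm k (\<lambda>l. f l (z + real_to_complex (t (r n))))" for n
      using that(1) z by (intro hol_map_CP_sqnorm_pos) auto
  qed
  show ?thesis
    unfolding almost_periodic_CP_def CP_limit_def
    by (intro conj_cong refl all_cong1 ex_cong1 imp_cong key)
qed

section \<open>Completeness: limits of rank-one projectors\<close>

lemma proj_entry_rank_one:
  "proj_entry k a i l * proj_entry k a p p = proj_entry k a i p * cnj (proj_entry k a l p)"
  by (simp add: proj_entry_def mult_ac)

lemma sum_proj_entry_diag:
  "0 < sqnorm k a \<Longrightarrow> (\<Sum>l\<le>k. proj_entry k a l l) = 1"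
  by (simp add: proj_entry_def complex_sqnorm[symmetric] flip: sum_divide_distrib)

text \<open>A diagonal entry of \<open>P^* P = P\<close>, from the vanishing of the minors and trace
  1.\<close>

lemma sum_proj_entry_column:
  assumes "0 < sqnorm k a"
  shows "(\<Sum>j\<le>k. proj_entry k a j p * cnj (proj_entry k a j p)) = proj_entry k a p p"
  by (simp add: proj_entry_rank_one[symmetric] sum_proj_entry_diag[OF assms] flip: sum_distrib_right)

text \<open>Every column of the projector onto the line of \<open>a\<close> is a multiple of
  \<open>a\<close>, so a nonzero column gives homogeneous coordinates back. The first two hypotheses
  are polynomial equations in the entries and their conjugates, hence are inherited by pointwise
  limits of projectors.\<close>

lemma proj_entry_of_column:
  assumes rank: "\<And>i l. i \<le> k \<Longrightarrow> l \<le> k \<Longrightarrow> Q i l * Q p p = Q i p * cnj (Q l p)"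
    and col: "(\<Sum>j\<le>k. Q j p * cnj (Q j p)) = Q p p" and "Q p p \<noteq> 0" "i \<le> k" "l \<le> k"
  shows "proj_entry k (\<lambda>j. Q j p) i l = Q i l"
  using assms by (simp add: proj_entry_def complex_sqnorm rank[symmetric])

lemma proj_entry_diag_eq_0_iff:
  "0 < sqnorm k a \<Longrightarrow> proj_entry k a l l = 0 \<longleftrightarrow> a l = 0"
  by (simp add: proj_entry_def)

lemma cmod_proj_entry_le_1:
  assumes "0 < sqnorm k a" "i \<le> k" "l \<le> k"
  shows "cmod (proj_entry k a i l) \<le> 1"
proof -
  have "cmod (a i) * cmod (a l) \<le> sqrt (sqnorm k a) * sqrt (sqnorm k a)"
    using assms by (intro mult_mono cmod_le_sqrt_sqnorm) auto
  then show ?thesis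
    using assms by (simp add: proj_entry_def norm_mult norm_divide)
qed

text \<open>Entrywise limits of rank-one projectors still satisfy the rank-one and idempotency
  equations and have trace 1, so each is the projector of one of its own columns.\<close>

lemma exists_CP_limit_of_uniformly_Cauchy:
  assumes nz: "\<And>n z. z \<in> tube \<Omega> \<Longrightarrow> 0 < sqnorm k (\<lambda>l. F n l z)"
    and cauchy: "\<And>\<Omega>' i l. compactly_in \<Omega>' \<Omega> \<Longrightarrow> i \<le> k \<Longrightarrow> l \<le> k \<Longrightarrow>
      uniformly_Cauchy_on (tube \<Omega>') (\<lambda>n z. proj_entry k (\<lambda>l. F n l z) i l)"
  obtains G where "CP_limit \<Omega> k F G"
proof -
  define P where "P n z i l = proj_entry k (\<lambda>l. F n l z) i l" for n z i l
  define Q where "Q z i l = lim (\<lambda>n. P n z i l)" for z i l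
  have lim: "(\<lambda>n. P n z i l) \<longlonglongrightarrow> Q z i l" if "z \<in> tube \<Omega>" "i \<le> k" "l \<le> k" for z i l
  proof -
    have "compactly_in {im_part z} \<Omega>"
      using that by (simp add: compactly_in_def tube_def)
    then have "uniformly_Cauchy_on (tube {im_part z}) (\<lambda>n z. P n z i l)"
      using cauchy that by (simp add: P_def)
    then have "Cauchy (\<lambda>n. P n z i l)"
      unfolding uniformly_Cauchy_on_def Cauchy_def by (simp add: tube_def) metis
    then show ?thesis
      unfolding Q_def by (simp add: Cauchy_convergent_iff convergent_LIMSEQ_iff)
  qed
  have rank: "Q z i l * Q z p p = Q z i p * cnj (Q z l p)"
    if "z \<in> tube \<Omega>" "i \<le> k" "l \<le> k" "p \<le> k" for z i l p
  proof (rule LIMSEQ_unique)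
    show "(\<lambda>n. P n z i l * P n z p p) \<longlonglongrightarrow> Q z i l * Q z p p"
      using that by (intro tendsto_intros lim)
    have "(\<lambda>n. P n z i p * cnj (P n z l p)) \<longlonglongrightarrow> Q z i p * cnj (Q z l p)"
      using that by (intro tendsto_intros lim)
    then show "(\<lambda>n. P n z i l * P n z p p) \<longlonglongrightarrow> Q z i p * cnj (Q z l p)"
      by (simp only: P_def proj_entry_rank_one)
  qed
  have col: "(\<Sum>j\<le>k. Q z j p * cnj (Q z j p)) = Q z p p" if "z \<in> tube \<Omega>" "p \<le> k" for z p
  proof (rule LIMSEQ_unique)
    show "(\<lambda>n. P n z p p) \<longlonglongrightarrow> Q z p p"
      using that by (intro lim)
    have "(\<lambda>n. \<Sum>j\<le>k. P n z j p * cnj (P n z j p)) \<longlonglongrightarrow> (\<Sum>j\<le>k. Q z j p * cnj (Q z j p))"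
      using that by (intro tendsto_intros lim) auto
    then show "(\<lambda>n. P n z p p) \<longlonglongrightarrow> (\<Sum>j\<le>k. Q z j p * cnj (Q z j p))"
      by (simp only: P_def sum_proj_entry_column[OF nz[OF that(1)]])
  qed
  \<comment> \<open>The trace stays 1 in the limit, so the diagonal cannot vanish
    altogether.\<close>
  have "\<exists>p\<le>k. Q z p p \<noteq> 0" if "z \<in> tube \<Omega>" for z
  proof -
    have "(\<lambda>n. \<Sum>l\<le>k. P n z l l) \<longlonglongrightarrow> (\<Sum>l\<le>k. Q z l l)"
      using that by (intro tendsto_intros lim) auto
    then have "(\<lambda>n. 1) \<longlonglongrightarrow> (\<Sum>l\<le>k. Q z l l)"
      by (simp only: P_def sum_proj_entry_diag[OF nz[OF that(1)]])
    then have "(\<Sum>l\<le>k. Q z l l) = 1"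
      using LIMSEQ_unique tendsto_const by blast
    then show ?thesis
      by (metis (no_types, lifting) atMost_iff sum.neutral zero_neq_one)
  qed
  then obtain p where p: "\<And>z. z \<in> tube \<Omega> \<Longrightarrow> p z \<le> k \<and> Q z (p z) (p z) \<noteq> 0"
    by metis
  \<comment> \<open>The column index depends on the point, so these vectors need not vary
    continuously; \<open>CP_limit\<close> does not ask for it.\<close>
  define G where "G z l = Q z l (p z)" for z l
  have G: "proj_entry k (G z) i l = Q z i l" if "z \<in> tube \<Omega>" "i \<le> k" "l \<le> k" for z i l
    unfolding G_def using that p rank col by (intro proj_entry_of_column) auto
  have "CP_limit \<Omega> k F G"
    unfolding CP_limit_def
  proof (intro conjI ballI allI impI)
    show "\<exists>l\<le>k. G z l \<noteq> 0" if "z \<in> tube \<Omega>" for z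
      using p[OF that] by (auto simp: G_def)
    fix \<Omega>' i l assume \<Omega>': "compactly_in \<Omega>' \<Omega>" and il: "i \<le> k" "l \<le> k"
    then have sub: "z \<in> tube \<Omega>' \<Longrightarrow> z \<in> tube \<Omega>" for z
      using compactly_in_subset tube_mono by blast
    have "uniform_limit (tube \<Omega>') (\<lambda>n z. P n z i l) (\<lambda>z. Q z i l) sequentially"
      unfolding Q_def using cauchy[OF \<Omega>' il] Cauchy_uniformly_convergent
      by (fastforce simp: P_def uniformly_convergent_uniform_limit_iff)
    then show "uniform_limit (tube \<Omega>') (\<lambda>n z. proj_entry k (\<lambda>l. F n l z) i l)
        (\<lambda>z. proj_entry k (G z) i l) sequentially"
      using G sub il by (subst uniform_limit_cong') (auto simp: P_def)
  qed
  then show thesis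
    by (rule that)
qed

section \<open>Holomorphic functions on tubes and zeros of limit maps\<close>

lemma continuous_on_im_part [continuous_intros]:
  "continuous_on S f \<Longrightarrow> continuous_on S (\<lambda>x. im_part (f x))"
  unfolding im_part_def by (intro continuous_intros)

lemma open_tube: "open \<Omega> \<Longrightarrow> open (tube \<Omega>)"
  unfolding tube_def using open_vimage[of \<Omega> im_part] continuous_on_im_part[OF continuous_on_id, of UNIV]
  by (simp add: vimage_def)

lemma im_part_add: "im_part (x + y) = im_part x + im_part y"
  by (simp add: im_part_def vec_eq_iff)

lemma im_part_scaleR: "im_part (c *\<^sub>R x) = c *\<^sub>R im_part x"
  by (simp add: im_part_def vec_eq_iff)

lemma convex_tube: "convex \<Omega> \<Longrightarrow> convex (tube \<Omega>)"
  unfolding convex_def tube_def by (simp add: im_part_add im_part_scaleR)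

lemma bounded_linear_vector_smult: "bounded_linear (\<lambda>x. x *s (v :: complex ^ 'm))"
  unfolding linear_conv_bounded_linear[symmetric]
  by (intro linearI) (simp_all add: vec_eq_iff algebra_simps)

lemma continuous_on_vector_smult [continuous_intros]:
  "continuous_on S f \<Longrightarrow> continuous_on S (\<lambda>x. f x *s (v :: complex ^ 'm))"
  using bounded_linear.continuous_on[OF bounded_linear_vector_smult] .

lemma hol_on_imp_continuous_on: "hol_on S f \<Longrightarrow> continuous_on S f"
  unfolding hol_on_def
  by (meson continuous_at_imp_continuous_on has_derivative_continuous)

text \<open>The derivative \<open>L\<close> is complex-linear, so along a complex line it acts as
  multiplication by \<open>L v\<close>; this opens the way to one-variable theory.\<close>

lemma hol_on_line:
  fixes f :: "complex ^ 'm \<Rightarrow> complex"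
  assumes "hol_on S f" and "\<And>\<zeta>. \<zeta> \<in> D \<Longrightarrow> z + \<zeta> *s v \<in> S"
  shows "(\<lambda>\<zeta>. f (z + \<zeta> *s v)) holomorphic_on D"
proof (rule holomorphic_onI)
  fix \<zeta> assume "\<zeta> \<in> D"
  then obtain L where L: "(f has_derivative L) (at (z + \<zeta> *s v))" "\<And>c v. L (c *s v) = c * L v"
    using assms unfolding hol_on_def by blast
  have "((\<lambda>\<zeta>. z + \<zeta> *s v) has_derivative (\<lambda>x. x *s v)) (at \<zeta>)"
    using has_derivative_add[OF has_derivative_const bounded_linear_imp_has_derivative[OF bounded_linear_vector_smult]]
    by simp
  from has_derivative_compose[OF this L(1)]
  have "((\<lambda>\<zeta>. f (z + \<zeta> *s v)) has_field_derivative (L v)) (at \<zeta>)"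
    by (simp add: has_field_derivative_def L(2) mult.commute[of _ "L v"])
  then show "(\<lambda>\<zeta>. f (z + \<zeta> *s v)) field_differentiable at \<zeta> within D"
    using field_differentiable_at_within field_differentiable_def by blast
qed

lemma continuous_on_proj_entry:
  assumes "\<And>l. l \<le> k \<Longrightarrow> continuous_on S (\<phi> l)" and "\<And>z. z \<in> S \<Longrightarrow> 0 < sqnorm k (\<lambda>l. \<phi> l z)"
    and "i \<le> k" "l \<le> k"
  shows "continuous_on S (\<lambda>z. proj_entry k (\<lambda>l. \<phi> l z) i l)"
proof -
  have "continuous_on S (\<lambda>z. sqnorm k (\<lambda>l. \<phi> l z))"
    unfolding sqnorm_def using assms by (intro continuous_intros) auto
  then show ?thesis
    unfolding proj_entry_def using assms by (intro continuous_intros) fastforce+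
qed

text \<open>Near \<open>\<zeta>0\<close> some component \<open>p\<close> of the limit does not vanish, and the affine coordinate
  of index \<open>l\<close> in the chart \<open>p\<close> is a uniform limit of holomorphic functions.\<close>
lemma projective_limit_zero_dichotomy:
  fixes \<Phi> :: "nat \<Rightarrow> nat \<Rightarrow> complex \<Rightarrow> complex"
  assumes S: "open S" and hol: "\<And>n l. l \<le> k \<Longrightarrow> \<Phi> n l holomorphic_on S"
    and \<Phi>: "\<And>n \<zeta>. \<zeta> \<in> S \<Longrightarrow> 0 < sqnorm k (\<lambda>l. \<Phi> n l \<zeta>)"
    and \<Gamma>: "\<And>\<zeta>. \<zeta> \<in> S \<Longrightarrow> 0 < sqnorm k (\<Gamma> \<zeta>)"
    and lim: "\<And>K i l. compact K \<Longrightarrow> K \<subseteq> S \<Longrightarrow> i \<le> k \<Longrightarrow> l \<le> k \<Longrightarrow>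
      uniform_limit K (\<lambda>n \<zeta>. proj_entry k (\<lambda>l. \<Phi> n l \<zeta>) i l)
        (\<lambda>\<zeta>. proj_entry k (\<Gamma> \<zeta>) i l) sequentially"
    and "\<zeta>0 \<in> S" "l \<le> k"
  shows "(\<forall>\<^sub>F \<zeta> in nhds \<zeta>0. \<Gamma> \<zeta> l = 0) \<or> (\<forall>\<^sub>F \<zeta> in at \<zeta>0. \<Gamma> \<zeta> l \<noteq> 0)"
proof -
  define P where "P n \<zeta> i l = proj_entry k (\<lambda>l. \<Phi> n l \<zeta>) i l" for n \<zeta> i l
  define Q where "Q \<zeta> i l = proj_entry k (\<Gamma> \<zeta>) i l" for \<zeta> i l
  obtain p where p: "p \<le> k" "\<Gamma> \<zeta>0 p \<noteq> 0"
    using \<Gamma>[OF \<open>\<zeta>0 \<in> S\<close>] unfolding sqnorm_def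
    by (metis (no_types, lifting) atMost_iff norm_zero order_less_irrefl power_zero_numeral sum.neutral)
  obtain r where r: "r > 0" "cball \<zeta>0 r \<subseteq> S"
    using S \<open>\<zeta>0 \<in> S\<close> open_contains_cball by blast
  have contQ: "continuous_on (cball \<zeta>0 r) (\<lambda>\<zeta>. Q \<zeta> p p)"
  proof (rule uniform_limit_theorem)
    show "uniform_limit (cball \<zeta>0 r) (\<lambda>n \<zeta>. P n \<zeta> p p) (\<lambda>\<zeta>. Q \<zeta> p p) sequentially"
      unfolding P_def Q_def using r p by (intro lim) auto
    show "\<forall>\<^sub>F n in sequentially. continuous_on (cball \<zeta>0 r) (\<lambda>\<zeta>. P n \<zeta> p p)"
      unfolding P_def using hol \<Phi> r p
      by (intro always_eventually allI continuous_on_proj_entry)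
        (auto intro: holomorphic_on_imp_continuous_on holomorphic_on_subset)
  qed simp
  \<comment> \<open>Half the value at the centre: near it the limit entry stays above
    \<open>c\<close>, and an approximant within \<open>c\<close> of such a value cannot
    vanish.\<close>
  define c where "c = cmod (Q \<zeta>0 p p) / 2"
  have c: "c > 0" "c < cmod (Q \<zeta>0 p p)"
    using p \<Gamma>[OF \<open>\<zeta>0 \<in> S\<close>] by (auto simp: c_def Q_def proj_entry_def)
  have "\<forall>\<^sub>F \<zeta> in at \<zeta>0. cmod (Q \<zeta> p p) > c"
  proof (rule order_tendstoD)
    show "((\<lambda>\<zeta>. cmod (Q \<zeta> p p)) \<longlongrightarrow> cmod (Q \<zeta>0 p p)) (at \<zeta>0)"
      using continuous_on_interior[OF contQ] r
      by (intro tendsto_norm) (simp add: isCont_def)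
  qed (use c in auto)
  then have "\<forall>\<^sub>F \<zeta> in nhds \<zeta>0. cmod (Q \<zeta> p p) > c"
    using c by (simp add: eventually_nhds_conv_at)
  then obtain r1 where r1: "r1 > 0" "\<And>\<zeta>. dist \<zeta> \<zeta>0 < r1 \<Longrightarrow> cmod (Q \<zeta> p p) > c"
    unfolding eventually_nhds_metric by blast
  define s where "s = min r (r1 / 2)"
  have s: "s > 0" "cball \<zeta>0 s \<subseteq> S" "\<And>\<zeta>. \<zeta> \<in> cball \<zeta>0 s \<Longrightarrow> cmod (Q \<zeta> p p) > c"
  proof -
    show "s > 0"
      using r r1 by (auto simp: s_def)
    show "cball \<zeta>0 s \<subseteq> S"
      using r by (auto simp: s_def)
    show "cmod (Q \<zeta> p p) > c" if "\<zeta> \<in> cball \<zeta>0 s" for \<zeta>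
      using that r1 by (intro r1(2)) (auto simp: s_def dist_commute)
  qed
  have ulim: "uniform_limit (cball \<zeta>0 s) (\<lambda>n \<zeta>. P n \<zeta> i j) (\<lambda>\<zeta>. Q \<zeta> i j) sequentially"
    if "i \<le> k" "j \<le> k" for i j
    unfolding P_def Q_def using s that by (intro lim) auto
  have "\<forall>\<^sub>F n in sequentially. \<forall>\<zeta>\<in>cball \<zeta>0 s. dist (P n \<zeta> p p) (Q \<zeta> p p) < c"
    using ulim[OF p(1) p(1)] c by (simp add: uniform_limit_iff)
  then obtain N where N: "\<And>n \<zeta>. n \<ge> N \<Longrightarrow> \<zeta> \<in> cball \<zeta>0 s \<Longrightarrow> dist (P n \<zeta> p p) (Q \<zeta> p p) < c"
    unfolding eventually_sequentially by blast
  have \<Phi>p: "\<Phi> n p \<zeta> \<noteq> 0" if "n \<ge> N" "\<zeta> \<in> cball \<zeta>0 s" for n \<zeta>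
    using N[OF that] s(3)[OF that(2)] by (auto simp: P_def proj_entry_def dist_norm)
  define quo where "quo \<zeta> = Q \<zeta> l p / Q \<zeta> p p" for \<zeta>
  have quot: "uniform_limit (cball \<zeta>0 s) (\<lambda>n \<zeta>. P n \<zeta> l p / P n \<zeta> p p) quo sequentially"
    unfolding quo_def
  proof (rule uniform_lim_divide)
    show "bounded ((\<lambda>\<zeta>. Q \<zeta> l p) ` cball \<zeta>0 s)"
      using cmod_proj_entry_le_1 \<Gamma> s(2) p \<open>l \<le> k\<close>
      by (auto simp: bounded_iff Q_def intro!: exI[of _ 1])
    show "c \<le> cmod (Q \<zeta> p p)" if "\<zeta> \<in> cball \<zeta>0 s" for \<zeta>
      using s(3)[OF that] by simp
  qed (use ulim p \<open>l \<le> k\<close> c in auto)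
  have quot_eq: "P n \<zeta> l p / P n \<zeta> p p = \<Phi> n l \<zeta> / \<Phi> n p \<zeta>" if "n \<ge> N" "\<zeta> \<in> cball \<zeta>0 s" for n \<zeta>
    using \<Phi>p[OF that] \<Phi>[of \<zeta> n] that s(2) by (auto simp: P_def proj_entry_def divide_simps)
  \<comment> \<open>The shift by \<open>N\<close> makes the denominators zero-free for every
    \<open>n\<close>, so that the whole sequence consists of holomorphic functions.\<close>
  have "uniform_limit (cball \<zeta>0 s) (\<lambda>n \<zeta>. P (n + N) \<zeta> l p / P (n + N) \<zeta> p p) quo sequentially"
    using quot unfolding uniform_limit_iff
    by (subst eventually_sequentially_seg[where k = N])
  then have quot': "uniform_limit (cball \<zeta>0 s) (\<lambda>n \<zeta>. \<Phi> (n + N) l \<zeta> / \<Phi> (n + N) p \<zeta>) quo sequentially"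
    by (rule uniform_limit_cong'[THEN iffD1, rotated -1]) (auto intro: quot_eq)
  have holquo: "quo holomorphic_on ball \<zeta>0 s"
  proof (rule holomorphic_uniform_sequence)
    show "(\<lambda>\<zeta>. \<Phi> (n + N) l \<zeta> / \<Phi> (n + N) p \<zeta>) holomorphic_on ball \<zeta>0 s" for n
      using s(2) p \<open>l \<le> k\<close> \<Phi>p[of "n + N"]
      by (intro holomorphic_on_divide holomorphic_on_subset[OF hol]) auto
    show "\<exists>d>0. cball x d \<subseteq> ball \<zeta>0 s \<and>
        uniform_limit (cball x d) (\<lambda>n \<zeta>. \<Phi> (n + N) l \<zeta> / \<Phi> (n + N) p \<zeta>) quo sequentially"
      if x: "x \<in> ball \<zeta>0 s" for x
    proof -
      obtain d where "d > 0" "cball x d \<subseteq> ball \<zeta>0 s"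
        using x open_ball open_contains_cball by blast
      moreover from this have "cball x d \<subseteq> cball \<zeta>0 s"
        using ball_subset_cball by blast
      ultimately show ?thesis
        using uniform_limit_on_subset[OF quot'] by blast
    qed
  qed simp
  \<comment> \<open>The quotient equals \<open>\<Gamma> \<zeta> l / \<Gamma> \<zeta> p\<close>,
    which is independent of the representative chosen for the limit point.\<close>
  have zero_iff: "\<Gamma> \<zeta> l = 0 \<longleftrightarrow> quo \<zeta> = 0" if "\<zeta> \<in> ball \<zeta>0 s" for \<zeta>
    using s(3)[of \<zeta>] that \<Gamma>[of \<zeta>] c by (auto simp: quo_def Q_def proj_entry_def)
  have ev: "\<forall>\<^sub>F \<zeta> in nhds \<zeta>0. \<zeta> \<in> ball \<zeta>0 s"
    using s(1) by (intro eventually_nhds_in_open) auto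
  show ?thesis
  proof (cases "\<forall>\<zeta>\<in>ball \<zeta>0 s. quo \<zeta> = 0")
    case True
    then have "\<forall>\<^sub>F \<zeta> in nhds \<zeta>0. \<Gamma> \<zeta> l = 0"
      using ev zero_iff by (auto elim: eventually_mono)
    then show ?thesis ..
  next
    case False
    then obtain \<beta> where "\<beta> \<in> ball \<zeta>0 s" "quo \<beta> \<noteq> 0"
      by blast
    then have "\<forall>\<^sub>F \<zeta> in at \<zeta>0. quo \<zeta> \<noteq> 0 \<and> \<zeta> \<in> ball \<zeta>0 s"
      using s(1) by (intro non_zero_neighbour_alt[OF holquo]) auto
    then have "\<forall>\<^sub>F \<zeta> in at \<zeta>0. \<Gamma> \<zeta> l \<noteq> 0"
      using zero_iff by (auto elim: eventually_mono)
    then show ?thesis ..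
  qed
qed

text \<open>An identity theorem on a complex line. Component \<open>l\<close> of \<open>G\<close> is
  not itself a holomorphic function, so the local alternatives (identically zero nearby, or at most
  an isolated zero) are glued by connectedness: they define disjoint open sets covering the
  parameters, and the point \<open>w\<close> at parameter 1 decides for \<open>z\<close> at
  parameter 0.\<close>

lemma projective_limit_line_zeros:
  fixes \<Omega> :: "(real ^ 'm) set"
  assumes \<Omega>: "open \<Omega>" "convex \<Omega>" and F: "\<And>n. hol_map_CP \<Omega> k (F n)" and lim: "CP_limit \<Omega> k F G"
    and z: "z \<in> tube \<Omega>" and w: "w \<in> tube \<Omega>" and l: "l \<le> k" "G w l \<noteq> 0"
  shows "\<forall>\<^sub>F \<zeta> in at 0. G (z + \<zeta> *s (w - z)) l \<noteq> 0"
proof -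
  define ln where "ln \<zeta> = z + \<zeta> *s (w - z)" for \<zeta>
  define S where "S = ln -` tube \<Omega>"
  have cont: "continuous_on A ln" for A
    unfolding ln_def by (intro continuous_intros)
  have S: "open S"
    unfolding S_def using open_tube[OF \<Omega>(1)] cont by (rule open_vimage)
  \<comment> \<open>Convexity of \<open>\<Omega>\<close> makes the set of parameters
    connected.\<close>
  have "convex S"
  proof (rule convexI)
    fix x y u v assume *: "x \<in> S" "y \<in> S" "0 \<le> u" "0 \<le> v" "u + v = (1::real)"
    then have v: "v = 1 - u"
      by simp
    have "ln (u *\<^sub>R x + v *\<^sub>R y) = u *\<^sub>R ln x + v *\<^sub>R ln y"
      unfolding ln_def v by (simp add: vec_eq_iff) (simp add: scaleR_conv_of_real algebra_simps)
    then show "u *\<^sub>R x + v *\<^sub>R y \<in> S"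
      using convexD[OF convex_tube[OF \<Omega>(2)], of "ln x" "ln y" u v] * by (simp add: S_def)
  qed
  have dichotomy: "(\<forall>\<^sub>F \<zeta> in nhds \<zeta>0. G (ln \<zeta>) l = 0) \<or> (\<forall>\<^sub>F \<zeta> in at \<zeta>0. G (ln \<zeta>) l \<noteq> 0)"
    if "\<zeta>0 \<in> S" for \<zeta>0
  proof (rule projective_limit_zero_dichotomy[where \<Phi> = "\<lambda>n l \<zeta>. F n l (ln \<zeta>)" and S = S])
    show "(\<lambda>\<zeta>. F n l (ln \<zeta>)) holomorphic_on S" if "l \<le> k" for n l
      unfolding ln_def using F[of n] that
      by (intro hol_on_line[of "tube \<Omega>"]) (auto simp: hol_map_CP_def S_def ln_def)
    show "0 < sqnorm k (\<lambda>l. F n l (ln \<zeta>))" if "\<zeta> \<in> S" for n \<zeta>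
      using that by (intro hol_map_CP_sqnorm_pos[OF F]) (simp add: S_def)
    show "0 < sqnorm k (G (ln \<zeta>))" if "\<zeta> \<in> S" for \<zeta>
      using that lim by (intro sqnorm_pos) (simp add: S_def CP_limit_def)
    fix K i j assume K: "compact K" "K \<subseteq> S" and ij: "i \<le> k" "j \<le> k"
    \<comment> \<open>A compact set of parameters has a compact set of imaginary parts below it, so
      convergence on the tube over that set applies.\<close>
    define \<Omega>' where "\<Omega>' = (\<lambda>\<zeta>. im_part (ln \<zeta>)) ` K"
    have "compact \<Omega>'"
      unfolding \<Omega>'_def using K cont by (intro compact_continuous_image continuous_on_im_part)
    then have "compactly_in \<Omega>' \<Omega>"
      using K by (auto simp: compactly_in_def compact_imp_bounded compact_imp_closed \<Omega>'_def S_def tube_def)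
    then have "uniform_limit (tube \<Omega>') (\<lambda>n z. proj_entry k (\<lambda>l. F n l z) i j)
        (\<lambda>z. proj_entry k (G z) i j) sequentially"
      using lim ij by (simp add: CP_limit_def)
    then show "uniform_limit K (\<lambda>n \<zeta>. proj_entry k (\<lambda>l. F n l (ln \<zeta>)) i j)
        (\<lambda>\<zeta>. proj_entry k (G (ln \<zeta>)) i j) sequentially"
      by (rule uniform_limit_compose') (auto simp: \<Omega>'_def tube_def)
  qed (use S l that in auto)
  define U where "U = {\<zeta>0 \<in> S. \<forall>\<^sub>F \<zeta> in nhds \<zeta>0. G (ln \<zeta>) l = 0}"
  define V where "V = {\<zeta>0 \<in> S. \<forall>\<^sub>F \<zeta> in at \<zeta>0. G (ln \<zeta>) l \<noteq> 0}"
  have "open U"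
  proof (subst open_subopen, rule ballI)
    fix x assume "x \<in> U"
    then obtain T where "open T" "x \<in> T" "\<And>y. y \<in> T \<Longrightarrow> G (ln y) l = 0"
      by (auto simp: U_def eventually_nhds)
    then have "open (S \<inter> T)" "x \<in> S \<inter> T" "S \<inter> T \<subseteq> U"
      using S \<open>x \<in> U\<close> by (auto simp: U_def eventually_nhds)
    then show "\<exists>T. open T \<and> x \<in> T \<and> T \<subseteq> U"
      by blast
  qed
  have "open V"
  proof (subst open_subopen, rule ballI)
    fix x assume "x \<in> V"
    then obtain T where T: "open T" "x \<in> T" "\<And>y. y \<in> T \<Longrightarrow> y \<noteq> x \<Longrightarrow> G (ln y) l \<noteq> 0"
      by (auto simp: V_def eventually_at_topological)
    have "S \<inter> T \<subseteq> V"
    proof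
      fix y assume y: "y \<in> S \<inter> T"
      show "y \<in> V"
      proof (cases "y = x")
        case False
        then have "\<forall>\<^sub>F \<zeta> in at y. G (ln \<zeta>) l \<noteq> 0"
          unfolding eventually_at_topological
          using T y by (intro exI[of _ "T - {x}"]) (auto simp: open_delete)
        then show ?thesis
          using y by (simp add: V_def)
      qed (use \<open>x \<in> V\<close> in simp)
    qed
    then show "\<exists>T. open T \<and> x \<in> T \<and> T \<subseteq> V"
      using S T \<open>x \<in> V\<close> by (intro exI[of _ "S \<inter> T"]) (auto simp: V_def)
  qed
  have "ln 1 = w"
    by (simp add: ln_def)
  then have "1 \<in> S" "1 \<notin> U"
    using w l eventually_nhds_x_imp_x by (fastforce simp: S_def U_def)+
  have "0 \<in> S"
    using z by (simp add: S_def ln_def)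
  have "U \<inter> V = {}"
  proof -
    have False if "\<forall>\<^sub>F \<zeta> in nhds \<zeta>0. G (ln \<zeta>) l = 0" "\<forall>\<^sub>F \<zeta> in at \<zeta>0. G (ln \<zeta>) l \<noteq> 0" for \<zeta>0
    proof -
      have "\<forall>\<^sub>F \<zeta> in at \<zeta>0. G (ln \<zeta>) l = 0"
        using that(1) by (simp add: eventually_nhds_conv_at)
      with that(2) have "\<forall>\<^sub>F \<zeta> in at \<zeta>0. False"
        by eventually_elim simp
      then show False
        by simp
    qed
    then show ?thesis
      by (auto simp: U_def V_def)
  qed
  moreover have "S \<subseteq> U \<union> V"
    using dichotomy by (auto simp: U_def V_def)
  moreover have "1 \<in> V"
    using \<open>1 \<in> S\<close> \<open>1 \<notin> U\<close> \<open>S \<subseteq> U \<union> V\<close> by blast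
  ultimately have "U \<inter> S = {}"
    using connectedD[OF convex_connected[OF \<open>convex S\<close>] \<open>open U\<close> \<open>open V\<close>] \<open>1 \<in> S\<close> by blast
  then have "0 \<in> V"
    using \<open>0 \<in> S\<close> \<open>S \<subseteq> U \<union> V\<close> by blast
  then show ?thesis
    by (simp add: V_def ln_def)
qed

lemma norm_vector_smult: "norm (c *s (v :: complex ^ 'm)) = cmod c * norm v"
  by (simp add: norm_vec_def norm_mult L2_set_right_distrib)

lemma norm_im_part_le: "norm (im_part z) \<le> norm z"
  by (rule norm_le_componentwise_cart) (simp add: im_part_def abs_Im_le_cmod)

text \<open>Leaves room for discs of radius \<open>d\<close> centred in one tube inside another tube
  on which uniform convergence is still available.\<close>

lemma compactly_in_enlarge:
  fixes \<Omega> :: "(real ^ 'm) set"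
  assumes "open \<Omega>" "compactly_in \<Omega>' \<Omega>"
  obtains d \<Omega>'' where "d > 0" "compactly_in \<Omega>'' \<Omega>"
    "\<And>z w. z \<in> tube \<Omega>' \<Longrightarrow> norm w \<le> d \<Longrightarrow> z + w \<in> tube \<Omega>''"
proof -
  have K: "compact (closure \<Omega>')" "closure \<Omega>' \<subseteq> \<Omega>"
    using assms by (auto simp: compactly_in_def)
  obtain d where d: "d > 0" "(\<Union>x\<in>closure \<Omega>'. cball x d) \<subseteq> \<Omega>"
    using compact_subset_open_imp_cball_epsilon_subset[OF K(1) assms(1) K(2)] by blast
  define \<Omega>'' where "\<Omega>'' = (\<Union>x\<in>closure \<Omega>'. cball x d)"
  have "compact \<Omega>''"
    unfolding \<Omega>''_def using K(1) by (rule compact_minkowski_sum_cball)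
  then have "compactly_in \<Omega>'' \<Omega>"
    using d by (simp add: compactly_in_def compact_imp_bounded compact_imp_closed \<Omega>''_def)
  moreover have "z + w \<in> tube \<Omega>''" if "z \<in> tube \<Omega>'" "norm w \<le> d" for z w
  proof -
    have "im_part z + im_part w \<in> cball (im_part z) d"
      using norm_im_part_le[of w] that by (simp add: dist_norm)
    then show ?thesis
      using that closure_subset by (auto simp: tube_def im_part_add \<Omega>''_def)
  qed
  ultimately show thesis
    using d that by blast
qed

section \<open>Translates, subsequences and continuity of limit maps\<close>

lemma hol_on_translate:
  assumes "hol_on (tube \<Omega>) f"
  shows "hol_on (tube \<Omega>) (\<lambda>z. f (z + real_to_complex t))"
  unfolding hol_on_def
proof
  fix z assume "z \<in> tube \<Omega>"
  then have "z + real_to_complex t \<in> tube \<Omega>"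
    by simp
  then obtain L where L: "(f has_derivative L) (at (z + real_to_complex t))" "\<forall>c v. L (c *s v) = c * L v"
    using assms unfolding hol_on_def by blast
  have "((\<lambda>z. z + real_to_complex t) has_derivative (\<lambda>x. x)) (at z)"
    by (auto intro!: derivative_eq_intros)
  from has_derivative_compose[OF this L(1)] L(2)
  show "\<exists>L. ((\<lambda>z. f (z + real_to_complex t)) has_derivative L) (at z) \<and> (\<forall>c v. L (c *s v) = c * L v)"
    by blast
qed

lemma hol_map_CP_translate:
  assumes "hol_map_CP \<Omega> k f"
  shows "hol_map_CP \<Omega> k (\<lambda>l z. f l (z + real_to_complex t))"
  unfolding hol_map_CP_def
proof (intro conjI allI impI ballI)
  fix l assume l: "l \<le> k"
  then show "hol_on (tube \<Omega>) (\<lambda>z. f l (z + real_to_complex t))"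
    using assms by (intro hol_on_translate) (simp add: hol_map_CP_def)
  obtain z where "z \<in> tube \<Omega>" "f l z \<noteq> 0"
    using assms l unfolding hol_map_CP_def by blast
  moreover have "z + real_to_complex (- t) + real_to_complex t = z"
    by (simp add: real_to_complex_def vec_eq_iff)
  ultimately show "\<exists>z\<in>tube \<Omega>. f l (z + real_to_complex t) \<noteq> 0"
    by (metis tube_translate)
qed (use assms in \<open>simp add: hol_map_CP_def\<close>)

lemma CP_limit_subseq:
  assumes "CP_limit \<Omega> k F G" "strict_mono r"
  shows "CP_limit \<Omega> k (\<lambda>n. F (r n)) G"
  using assms filterlim_compose[OF _ filterlim_subseq[OF assms(2)]]
  unfolding CP_limit_def by fastforce

lemma CP_limit_sqnorm_pos: "CP_limit \<Omega> k F G \<Longrightarrow> z \<in> tube \<Omega> \<Longrightarrow> 0 < sqnorm k (G z)"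
  unfolding CP_limit_def by (intro sqnorm_pos) auto

lemma CP_limit_Cauchy:
  assumes "CP_limit \<Omega> k F G" "compactly_in \<Omega>' \<Omega>" "0 < \<eta>"
  obtains N where "\<And>m n z i l. \<lbrakk>m \<ge> N; n \<ge> N; z \<in> tube \<Omega>'; i \<le> k; l \<le> k\<rbrakk> \<Longrightarrow>
    cmod (proj_entry k (\<lambda>l. F m l z) i l - proj_entry k (\<lambda>l. F n l z) i l) \<le> \<eta>"
proof -
  have "\<forall>\<^sub>F n in sequentially. \<forall>i\<in>{..k}. \<forall>l\<in>{..k}. \<forall>z\<in>tube \<Omega>'.
      dist (proj_entry k (\<lambda>l. F n l z) i l) (proj_entry k (G z) i l) < \<eta> / 2"
    using assms by (intro eventually_ball_finite[OF finite_atMost] ballI uniform_limitD)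
      (auto simp: CP_limit_def)
  then obtain N where N: "\<And>n i l z. \<lbrakk>n \<ge> N; i \<le> k; l \<le> k; z \<in> tube \<Omega>'\<rbrakk> \<Longrightarrow>
      dist (proj_entry k (\<lambda>l. F n l z) i l) (proj_entry k (G z) i l) < \<eta> / 2"
    unfolding eventually_sequentially by (metis atMost_iff)
  have "cmod (proj_entry k (\<lambda>l. F m l z) i l - proj_entry k (\<lambda>l. F n l z) i l) \<le> \<eta>"
    if "m \<ge> N" "n \<ge> N" "z \<in> tube \<Omega>'" "i \<le> k" "l \<le> k" for m n z i l
    using dist_triangle_half_l[OF N N, of m i l z n] that by (simp add: dist_norm)
  then show thesis
    by (rule that)
qed

text \<open>The vectors \<open>G z\<close> may jump between proportional choices, but the entries
  are locally uniform limits of continuous functions.\<close>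

lemma continuous_on_CP_limit:
  fixes \<Omega> :: "(real ^ 'm) set"
  assumes "open \<Omega>" and F: "\<And>n. hol_map_CP \<Omega> k (F n)" and lim: "CP_limit \<Omega> k F G"
    and "i \<le> k" "l \<le> k"
  shows "continuous_on (tube \<Omega>) (\<lambda>z. proj_entry k (G z) i l)"
proof (rule continuous_at_imp_continuous_on, rule ballI)
  fix z assume z: "z \<in> tube \<Omega>"
  then obtain e where e: "e > 0" "cball (im_part z) e \<subseteq> \<Omega>"
    using \<open>open \<Omega>\<close> unfolding open_contains_cball tube_def by blast
  define \<Omega>' where "\<Omega>' = ball (im_part z) e"
  have sub: "\<Omega>' \<subseteq> \<Omega>"
    using e ball_subset_cball unfolding \<Omega>'_def by blast
  have "compactly_in \<Omega>' \<Omega>"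
    using e by (simp add: compactly_in_def \<Omega>'_def)
  then have "uniform_limit (tube \<Omega>') (\<lambda>n z. proj_entry k (\<lambda>l. F n l z) i l)
      (\<lambda>z. proj_entry k (G z) i l) sequentially"
    using lim assms(4,5) by (simp add: CP_limit_def)
  moreover have "continuous_on (tube \<Omega>') (\<lambda>z. proj_entry k (\<lambda>l. F n l z) i l)" for n
  proof (rule continuous_on_proj_entry)
    show "continuous_on (tube \<Omega>') (F n l)" if "l \<le> k" for l
      using F[of n] that hol_on_imp_continuous_on continuous_on_subset tube_mono[OF sub]
      unfolding hol_map_CP_def by blast
    show "0 < sqnorm k (\<lambda>l. F n l z)" if "z \<in> tube \<Omega>'" for z
      using that F tube_mono[OF sub] by (intro hol_map_CP_sqnorm_pos[of \<Omega>]) auto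
  qed (use assms in auto)
  ultimately have "continuous_on (tube \<Omega>') (\<lambda>z. proj_entry k (G z) i l)"
    by (intro uniform_limit_theorem[OF always_eventually]) auto
  moreover have "open (tube \<Omega>')" "z \<in> tube \<Omega>'"
    using e by (auto simp: \<Omega>'_def intro!: open_tube) (simp add: tube_def)
  ultimately show "isCont (\<lambda>z. proj_entry k (G z) i l) z"
    by (simp add: continuous_on_eq_continuous_at)
qed

text \<open>Makes the results on limit maps applicable to the coordinates of a single map.\<close>

lemma CP_limit_const:
  assumes "hol_map_CP \<Omega> k f"
  shows "CP_limit \<Omega> k (\<lambda>n. f) (\<lambda>z l. f l z)"
  using assms by (auto simp: CP_limit_def hol_map_CP_def uniform_limit_const)

section \<open>Open dense sets where a component of a limit map does not vanish\<close>

lemma open_nonzero_component: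
  fixes \<Omega> :: "(real ^ 'm) set"
  assumes "open \<Omega>" "\<And>n. hol_map_CP \<Omega> k (F n)" "CP_limit \<Omega> k F G" "l \<le> k"
  shows "open {z \<in> tube \<Omega>. G z l \<noteq> 0}"
proof -
  have "continuous_on (tube \<Omega>) (\<lambda>z. proj_entry k (G z) l l)"
    using assms by (intro continuous_on_CP_limit[where F = F]) auto
  then have "open (tube \<Omega> \<inter> (\<lambda>z. proj_entry k (G z) l l) -` (- {0}))"
    using open_tube[OF assms(1)] by (intro continuous_open_preimage) auto
  also have "tube \<Omega> \<inter> (\<lambda>z. proj_entry k (G z) l l) -` (- {0}) = {z \<in> tube \<Omega>. G z l \<noteq> 0}"
    using proj_entry_diag_eq_0_iff[OF CP_limit_sqnorm_pos[OF assms(3)]] by auto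
  finally show ?thesis .
qed

text \<open>Any point \<open>z\<close> is approached along the complex line towards
  \<open>w\<close>, on which the component is nonzero for all small nonzero parameters.\<close>

lemma dense_nonzero_component:
  fixes \<Omega> :: "(real ^ 'm) set"
  assumes "open \<Omega>" "convex \<Omega>" "\<And>n. hol_map_CP \<Omega> k (F n)" "CP_limit \<Omega> k F G" "l \<le> k"
    and w: "w \<in> tube \<Omega>" "G w l \<noteq> 0"
  shows "tube \<Omega> \<subseteq> closure {z \<in> tube \<Omega>. G z l \<noteq> 0}"
proof
  fix z assume z: "z \<in> tube \<Omega>"
  let ?p = "\<lambda>\<zeta>. z + \<zeta> *s (w - z)"
  have "continuous_on UNIV ?p"
    by (intro continuous_intros)
  then have p: "(?p \<longlongrightarrow> z) (at 0)"
    by (auto simp: continuous_on_def dest: spec[of _ 0])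
  then have "\<forall>\<^sub>F \<zeta> in at 0. ?p \<zeta> \<in> tube \<Omega>"
    using open_tube[OF assms(1)] z by (rule topological_tendstoD)
  moreover have "\<forall>\<^sub>F \<zeta> in at 0. G (?p \<zeta>) l \<noteq> 0"
    using assms z by (intro projective_limit_line_zeros[where F = F]) auto
  ultimately have "\<forall>\<^sub>F \<zeta> in at 0. ?p \<zeta> \<in> closure {z \<in> tube \<Omega>. G z l \<noteq> 0}"
    by eventually_elim (auto intro: closure_subset[THEN subsetD])
  then show "z \<in> closure {z \<in> tube \<Omega>. G z l \<noteq> 0}"
    using p by (intro Lim_in_closed_set) auto
qed

text \<open>Uniformity on whole tubes, rather than on compact sets, is what keeps a component
  from dying out in the limit.\<close>
lemma translate_limit_nonzero_component:
  fixes \<Omega> :: "(real ^ 'm) set"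
  assumes f: "hol_map_CP \<Omega> k f"
    and lim: "CP_limit \<Omega> k (\<lambda>n l z. f l (z + real_to_complex (t n))) G" and l: "l \<le> k"
  obtains w where "w \<in> tube \<Omega>" "G w l \<noteq> 0"
proof -
  obtain w where w: "w \<in> tube \<Omega>" "f l w \<noteq> 0"
    using f l unfolding hol_map_CP_def by blast
  define c where "c = cmod (proj_entry k (\<lambda>l. f l w) l l)"
  have "c > 0"
    using w proj_entry_diag_eq_0_iff[OF hol_map_CP_sqnorm_pos[OF f w(1)]] by (simp add: c_def)
  have "compactly_in {im_part w} \<Omega>"
    using w by (simp add: compactly_in_def tube_def)
  then have "\<forall>\<^sub>F n in sequentially. \<forall>z\<in>tube {im_part w}.
      dist (proj_entry k (\<lambda>l. f l (z + real_to_complex (t n))) l l) (proj_entry k (G z) l l) < c"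
    using lim l \<open>c > 0\<close> by (simp add: CP_limit_def uniform_limit_iff)
  then obtain n where n: "\<And>z. z \<in> tube {im_part w} \<Longrightarrow>
      dist (proj_entry k (\<lambda>l. f l (z + real_to_complex (t n))) l l) (proj_entry k (G z) l l) < c"
    unfolding eventually_sequentially by blast
  \<comment> \<open>Shifting back by \<open>t n\<close> puts the fixed point \<open>w\<close> into
    the argument of \<open>f\<close>. The shifted point depends on \<open>n\<close> but stays in the
    fibre over \<open>im_part w\<close>, where convergence is uniform.\<close>
  define z where "z = w + real_to_complex (- t n)"
  have "z + real_to_complex (t n) = w"
    by (simp add: z_def real_to_complex_def vec_eq_iff)
  moreover have "z \<in> tube {im_part w}" "z \<in> tube \<Omega>"
    using w(1) by (simp_all add: z_def) (simp add: tube_def)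
  ultimately have "dist (proj_entry k (\<lambda>l. f l w) l l) (proj_entry k (G z) l l) < c"
    using n[of z] by simp
  then have "G z l \<noteq> 0"
    by (auto simp: c_def proj_entry_def dist_norm)
  then show thesis
    using \<open>z \<in> tube \<Omega>\<close> that by blast
qed

text \<open>A finite form of Baire's theorem; the induction rests on the fact that an open set
  meeting the closure of \<open>V\<close> meets \<open>V\<close>.\<close>

lemma finite_dense_open_Inter:
  assumes "finite \<V>" "open T" "T \<noteq> {}" and "\<And>V. V \<in> \<V> \<Longrightarrow> open V \<and> T \<subseteq> closure V"
  shows "T \<inter> \<Inter>\<V> \<noteq> {}"
  using assms(1,4)
proof (induction)
  case (insert V \<V>)
  have "open (T \<inter> \<Inter>\<V>)"
    using insert assms(2) by (intro open_Int open_Inter) auto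
  moreover have "T \<inter> \<Inter>\<V> \<inter> closure V \<noteq> {}"
    using insert by blast
  ultimately have "T \<inter> \<Inter>\<V> \<inter> V \<noteq> {}"
    using open_Int_closure_eq_empty by blast
  then show ?case
    by auto
qed (use assms(3) in simp)

text \<open>On the compact limit circle all components have a common positive lower bound. Passing
  to the sequence changes both the map and the centre of the circle, and each change costs at most a
  third of that bound.\<close>

lemma circle_lower_bound:
  fixes \<Omega> :: "(real ^ 'm) set"
  assumes "open \<Omega>" and F: "\<And>n. hol_map_CP \<Omega> k (F n)" and lim: "CP_limit \<Omega> k F G"
    and u: "u \<longlonglongrightarrow> z" and e: "cball z e \<subseteq> tube \<Omega>" and v: "norm v < e / 2"
    and nz: "\<And>\<zeta> l. \<zeta> \<in> sphere 0 1 \<Longrightarrow> l \<le> k \<Longrightarrow> G (z + \<zeta> *s v) l \<noteq> 0"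
  obtains c where "c > 0" "\<forall>\<^sub>F n in sequentially. \<forall>l\<in>{..k}. \<forall>\<zeta>\<in>sphere 0 1.
    c \<le> cmod (proj_entry k (\<lambda>l. F n l (u n + \<zeta> *s v)) l l)"
proof -
  define A where "A l w = proj_entry k (G w) l l" for l w
  have "e > 0"
    using v norm_ge_zero[of v] by linarith
  have vin: "z + \<zeta> *s v \<in> cball z e" if "\<zeta> \<in> sphere 0 1" for \<zeta>
    using that v \<open>e > 0\<close> by (simp add: dist_norm norm_vector_smult)
  have contA: "continuous_on (cball z e) (A l)" if "l \<le> k" for l
    unfolding A_def using assms that
    by (intro continuous_on_subset[OF continuous_on_CP_limit[where F = F] e]) auto
  have "\<exists>c>0. \<forall>\<zeta>\<in>sphere 0 1. c \<le> cmod (A l (z + \<zeta> *s v))" if l: "l \<le> k" for l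
  proof -
    have "continuous_on (sphere 0 1) (\<lambda>\<zeta>. cmod (A l (z + \<zeta> *s v)))"
      using vin by (intro continuous_on_norm continuous_on_compose2[OF contA[OF l]] continuous_intros) auto
    moreover have "sphere (0::complex) 1 \<noteq> {}"
      by (auto intro!: exI[of _ 1])
    ultimately obtain \<zeta>0 where \<zeta>0: "\<zeta>0 \<in> sphere 0 1"
      "\<And>\<zeta>. \<zeta> \<in> sphere 0 1 \<Longrightarrow> cmod (A l (z + \<zeta>0 *s v)) \<le> cmod (A l (z + \<zeta> *s v))"
      using continuous_attains_inf[OF compact_sphere] by metis
    moreover have "0 < cmod (A l (z + \<zeta>0 *s v))"
      using nz[OF \<zeta>0(1) l] proj_entry_diag_eq_0_iff[OF CP_limit_sqnorm_pos[OF lim]] vin[OF \<zeta>0(1)] e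
      by (auto simp: A_def)
    ultimately show ?thesis
      by blast
  qed
  then obtain c where c: "\<And>l. l \<le> k \<Longrightarrow> c l > 0"
    "\<And>l \<zeta>. l \<le> k \<Longrightarrow> \<zeta> \<in> sphere 0 1 \<Longrightarrow> c l \<le> cmod (A l (z + \<zeta> *s v))"
    by metis
  define C where "C = Min (c ` {..k})"
  have C: "C > 0" "\<And>l. l \<le> k \<Longrightarrow> C \<le> c l"
    unfolding C_def using c(1) by (auto simp: Min_gr_iff)
  define \<Omega>' where "\<Omega>' = im_part ` cball z e"
  have "compact \<Omega>'"
    unfolding \<Omega>'_def by (intro compact_continuous_image continuous_on_im_part continuous_on_id compact_cball)
  then have \<Omega>': "compactly_in \<Omega>' \<Omega>"
    using e by (auto simp: compactly_in_def compact_imp_bounded compact_imp_closed \<Omega>'_def tube_def)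
  \<comment> \<open>Centre and radius use up half of \<open>e\<close> each, so the moving circles
    eventually stay in the compact ball.\<close>
  have near: "\<forall>\<^sub>F n in sequentially. \<forall>\<zeta>\<in>sphere 0 1. u n + \<zeta> *s v \<in> cball z e"
  proof -
    have "\<forall>\<^sub>F n in sequentially. dist (u n) z < e / 2"
      using u \<open>e > 0\<close> by (intro tendstoD) auto
    then show ?thesis
    proof eventually_elim
      case (elim n)
      have "dist z (u n + \<zeta> *s v) \<le> e" if "\<zeta> \<in> sphere 0 1" for \<zeta>
      proof -
        have "norm (u n - z + \<zeta> *s v) \<le> norm (u n - z) + norm (\<zeta> *s v)"
          by (rule norm_triangle_ineq)
        then show ?thesis
          using elim v that by (simp add: dist_norm norm_vector_smult norm_minus_commute algebra_simps)
      qed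
      then show ?case
        by simp
    qed
  qed
  have "\<forall>\<^sub>F n in sequentially. \<forall>\<zeta>\<in>sphere 0 1.
      C / 3 \<le> cmod (proj_entry k (\<lambda>l. F n l (u n + \<zeta> *s v)) l l)" if l: "l \<le> k" for l
  proof -
    have "uniform_limit (sphere 0 1) (\<lambda>n \<zeta>. A l (u n + \<zeta> *s v)) (\<lambda>\<zeta>. A l (z + \<zeta> *s v)) sequentially"
    proof (rule uniform_limit_compose_uniformly_continuous_on[OF _ _ near])
      show "uniform_limit (sphere 0 1) (\<lambda>n \<zeta>. u n + \<zeta> *s v) (\<lambda>\<zeta>. z + \<zeta> *s v) sequentially"
        using u by (simp add: uniform_limit_iff tendsto_iff)
      show "uniformly_continuous_on (cball z e) (A l)"
        using contA[OF l] by (rule compact_uniformly_continuous) simp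
    qed simp
    then have 1: "\<forall>\<^sub>F n in sequentially. \<forall>\<zeta>\<in>sphere 0 1.
        dist (A l (u n + \<zeta> *s v)) (A l (z + \<zeta> *s v)) < C / 3"
      using C by (intro uniform_limitD) auto
    have 2: "\<forall>\<^sub>F n in sequentially. \<forall>w\<in>tube \<Omega>'. dist (proj_entry k (\<lambda>l. F n l w) l l) (A l w) < C / 3"
      unfolding A_def using lim \<Omega>' l C by (intro uniform_limitD) (auto simp: CP_limit_def)
    from 1 2 near show ?thesis
    proof eventually_elim
      case (elim n)
      show ?case
      proof
        fix \<zeta> :: complex assume \<zeta>: "\<zeta> \<in> sphere 0 1"
        then have "u n + \<zeta> *s v \<in> tube \<Omega>'"
          using elim(3) by (auto simp: tube_def \<Omega>'_def)
        then have "dist (proj_entry k (\<lambda>l. F n l (u n + \<zeta> *s v)) l l) (A l (u n + \<zeta> *s v)) < C / 3"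
          using elim(2) by blast
        moreover have "dist (A l (u n + \<zeta> *s v)) (A l (z + \<zeta> *s v)) < C / 3"
          using elim(1) \<zeta> by blast
        ultimately have "dist (proj_entry k (\<lambda>l. F n l (u n + \<zeta> *s v)) l l) (A l (z + \<zeta> *s v)) < C / 3 + C / 3"
          using dist_triangle[of "proj_entry k (\<lambda>l. F n l (u n + \<zeta> *s v)) l l" "A l (z + \<zeta> *s v)" "A l (u n + \<zeta> *s v)"]
          by linarith
        moreover have "C \<le> cmod (A l (z + \<zeta> *s v))"
          using C(2)[OF l] c(2)[OF l \<zeta>] by simp
        ultimately show "C / 3 \<le> cmod (proj_entry k (\<lambda>l. F n l (u n + \<zeta> *s v)) l l)"
          using norm_triangle_ineq2[of "A l (z + \<zeta> *s v)" "proj_entry k (\<lambda>l. F n l (u n + \<zeta> *s v)) l l"]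
          by (simp add: dist_norm norm_minus_commute)
      qed
    qed
  qed
  then have "\<forall>\<^sub>F n in sequentially. \<forall>l\<in>{..k}. \<forall>\<zeta>\<in>sphere 0 1.
      C / 3 \<le> cmod (proj_entry k (\<lambda>l. F n l (u n + \<zeta> *s v)) l l)"
    by (intro eventually_ball_finite[OF finite_atMost]) auto
  then show thesis
    using C that[of "C / 3"] by simp
qed

section \<open>Circles avoiding the zeros\<close>

text \<open>Otherwise some real translates of \<open>f\<close> and \<open>f'\<close> would converge to maps for which no complex
  line through some point of the tube avoids the zeros of all the components on small circles.\<close>
lemma uniform_circles:
  fixes \<Omega> :: "(real ^ 'm) set"
  assumes \<Omega>: "open \<Omega>" "convex \<Omega>" "\<Omega> \<noteq> {}"
    and ap: "almost_periodic_CP \<Omega> k f" "almost_periodic_CP \<Omega> k f'"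
    and \<Omega>': "compactly_in \<Omega>' \<Omega>" and d: "d > 0"
  obtains c where "c > 0"
    "\<And>z. z \<in> tube \<Omega>' \<Longrightarrow> \<exists>v. norm v < d \<and> (\<forall>l\<in>{..k}. \<forall>\<zeta>\<in>sphere 0 1.
      c \<le> cmod (proj_entry k (\<lambda>l. f l (z + \<zeta> *s v)) l l) \<and>
      c \<le> cmod (proj_entry k (\<lambda>l. f' l (z + \<zeta> *s v)) l l))"
proof -
  define good where "good c z v \<longleftrightarrow> norm v < d \<and> (\<forall>l\<in>{..k}. \<forall>\<zeta>\<in>sphere 0 1.
      c \<le> cmod (proj_entry k (\<lambda>l. f l (z + \<zeta> *s v)) l l) \<and>
      c \<le> cmod (proj_entry k (\<lambda>l. f' l (z + \<zeta> *s v)) l l))" for c z v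
  have "\<exists>c>0. \<forall>z\<in>tube \<Omega>'. \<exists>v. good c z v"
  proof (rule ccontr)
    assume "\<not> (\<exists>c>0. \<forall>z\<in>tube \<Omega>'. \<exists>v. good c z v)"
    then have "\<forall>n. \<exists>z\<in>tube \<Omega>'. \<forall>v. \<not> good (1 / real (Suc n)) z v"
      by (metis of_nat_0_less_iff zero_less_Suc zero_less_divide_1_iff)
    then obtain z where z: "\<And>n. z n \<in> tube \<Omega>'" "\<And>n v. \<not> good (1 / real (Suc n)) (z n) v"
      by metis
    \<comment> \<open>Each bad point splits into a purely imaginary point and a real vector. The
      imaginary parts stay in a compact set; the real vectors may be unbounded and are absorbed into
      translates of the maps.\<close>
    define x where "x n = (\<chi> j. Re (z n $ j))" for n
    define J :: "real ^ 'm \<Rightarrow> complex ^ 'm" where "J y = (\<chi> j. \<i> * complex_of_real (y $ j))" for y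
    have z_eq: "z n = J (im_part (z n)) + real_to_complex (x n)" for n
      by (simp add: vec_eq_iff J_def im_part_def real_to_complex_def x_def complex_eq_iff)
    have im_J: "im_part (J y) = y" for y
      by (simp add: vec_eq_iff J_def im_part_def)
    have cont_J: "continuous_on UNIV J"
      unfolding J_def by (intro continuous_intros)
    have K: "compact (closure \<Omega>')" "closure \<Omega>' \<subseteq> \<Omega>"
      using \<Omega>' by (auto simp: compactly_in_def)
    have "im_part (z n) \<in> closure \<Omega>'" for n
      using z(1)[of n] closure_subset by (auto simp: tube_def)
    then obtain y s where y: "y \<in> closure \<Omega>'" and s: "strict_mono s"
      and lim_y: "((\<lambda>n. im_part (z n)) \<circ> s) \<longlonglongrightarrow> y"
      using seq_compactE[OF compact_imp_seq_compact[OF K(1)], of "\<lambda>n. im_part (z n)"] by blast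
    obtain r1 G where r1: "strict_mono r1" "CP_limit \<Omega> k (\<lambda>n l z. f l (z + real_to_complex (x (s (r1 n))))) G"
      using ap(1)[unfolded almost_periodic_CP_iff, THEN conjunct2, rule_format, of "\<lambda>n. x (s n)"]
      by blast
    \<comment> \<open>The second extraction runs along the first, so both maps converge along a
      common subsequence.\<close>
    obtain r2 G' where r2: "strict_mono r2"
      "CP_limit \<Omega> k (\<lambda>n l z. f' l (z + real_to_complex (x (s (r1 (r2 n)))))) G'"
      using ap(2)[unfolded almost_periodic_CP_iff, THEN conjunct2, rule_format, of "\<lambda>n. x (s (r1 n))"]
      by blast
    define \<sigma> where "\<sigma> n = s (r1 (r2 n))" for n
    have \<sigma>: "strict_mono \<sigma>"
      using s r1(1) r2(1) by (simp add: \<sigma>_def strict_mono_def)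
    define F where "F = (\<lambda>n l z. f l (z + real_to_complex (x (\<sigma> n))))"
    define F' where "F' = (\<lambda>n l z. f' l (z + real_to_complex (x (\<sigma> n))))"
    have hol: "hol_map_CP \<Omega> k f" "hol_map_CP \<Omega> k f'"
      using ap by (auto simp: almost_periodic_CP_def)
    have F: "hol_map_CP \<Omega> k (F n)" "hol_map_CP \<Omega> k (F' n)" for n
      unfolding F_def F'_def using hol by (intro hol_map_CP_translate; simp)+
    have lim: "CP_limit \<Omega> k F G" "CP_limit \<Omega> k F' G'"
      using CP_limit_subseq[OF r1(2) r2(1)] r2(2) by (simp_all add: F_def F'_def \<sigma>_def)
    define V where "V l = {z \<in> tube \<Omega>. G z l \<noteq> 0}" for l
    define V' where "V' l = {z \<in> tube \<Omega>. G' z l \<noteq> 0}" for l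
    have V: "open (V l) \<and> tube \<Omega> \<subseteq> closure (V l)" "open (V' l) \<and> tube \<Omega> \<subseteq> closure (V' l)" if l: "l \<le> k" for l
    proof -
      obtain w where "w \<in> tube \<Omega>" "G w l \<noteq> 0"
        by (rule translate_limit_nonzero_component[OF hol(1) lim(1)[unfolded F_def] l])
      then show "open (V l) \<and> tube \<Omega> \<subseteq> closure (V l)"
        unfolding V_def using open_nonzero_component[OF \<Omega>(1) F(1) lim(1) l]
          dense_nonzero_component[OF \<Omega>(1,2) F(1) lim(1) l] by blast
      obtain w where "w \<in> tube \<Omega>" "G' w l \<noteq> 0"
        by (rule translate_limit_nonzero_component[OF hol(2) lim(2)[unfolded F'_def] l])
      then show "open (V' l) \<and> tube \<Omega> \<subseteq> closure (V' l)"
        unfolding V'_def using open_nonzero_component[OF \<Omega>(1) F(2) lim(2) l]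
          dense_nonzero_component[OF \<Omega>(1,2) F(2) lim(2) l] by blast
    qed
    have "J y \<in> tube \<Omega>"
      using y K(2) by (auto simp: tube_def im_J)
    \<comment> \<open>A point \<open>w\<close> off all \<open>2 (k+1)\<close> zero sets fixes one
      line along which every component of both limits is nonzero near \<open>J y\<close>, except
      possibly at \<open>J y\<close> itself.\<close>
    then have "tube \<Omega> \<inter> \<Inter>(V ` {..k} \<union> V' ` {..k}) \<noteq> {}"
      using V open_tube[OF \<Omega>(1)] by (intro finite_dense_open_Inter) auto
    then obtain w where w: "w \<in> tube \<Omega>" "\<And>l. l \<le> k \<Longrightarrow> G w l \<noteq> 0" "\<And>l. l \<le> k \<Longrightarrow> G' w l \<noteq> 0"
      by (auto simp: V_def V'_def)
    define v0 where "v0 = w - J y"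
    have "\<forall>\<^sub>F \<zeta> in at 0. \<forall>l\<in>{..k}. G (J y + \<zeta> *s v0) l \<noteq> 0 \<and> G' (J y + \<zeta> *s v0) l \<noteq> 0"
      unfolding v0_def using w \<open>J y \<in> tube \<Omega>\<close>
      by (intro eventually_ball_finite[OF finite_atMost] ballI eventually_conj
          projective_limit_line_zeros[OF \<Omega>(1,2) F(1) lim(1)]
          projective_limit_line_zeros[OF \<Omega>(1,2) F(2) lim(2)]) auto
    then obtain \<rho> where \<rho>: "\<rho> > 0" "\<And>\<zeta> l. \<lbrakk>\<zeta> \<noteq> 0; cmod \<zeta> < \<rho>; l \<le> k\<rbrakk> \<Longrightarrow>
        G (J y + \<zeta> *s v0) l \<noteq> 0 \<and> G' (J y + \<zeta> *s v0) l \<noteq> 0"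
      unfolding eventually_at by (auto simp: dist_norm)
    obtain e where e: "e > 0" "cball (J y) e \<subseteq> tube \<Omega>"
      using open_tube[OF \<Omega>(1)] \<open>J y \<in> tube \<Omega>\<close> open_contains_cball by blast
    define m where "m = min d (e / 2)"
    have m: "m > 0" "m \<le> d" "m \<le> e / 2"
      using d e by (auto simp: m_def)
    \<comment> \<open>The first bound avoids the zeros, the second makes the radius
      \<open>R * norm v0\<close> smaller than \<open>m\<close>; the \<open>+ 1\<close> covers
      \<open>v0 = 0\<close>.\<close>
    define R where "R = min (\<rho> / 2) (m / (norm v0 + 1))"
    have "norm v0 + 1 > 0"
      by (simp add: add_nonneg_pos)
    then have R: "R > 0" "R < \<rho>" "R * (norm v0 + 1) \<le> m"
      using \<rho>(1) m by (auto simp: R_def min_mult_distrib_right)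
    define v where "v = complex_of_real R *s v0"
    have "norm v < m"
      using R by (simp add: v_def norm_vector_smult algebra_simps)
    then have v: "norm v < d" "norm v < e / 2"
      using m by auto
    have nz: "G (J y + \<zeta> *s v) l \<noteq> 0" "G' (J y + \<zeta> *s v) l \<noteq> 0" if "\<zeta> \<in> sphere 0 1" "l \<le> k" for \<zeta> l
    proof -
      have "\<zeta> * complex_of_real R \<noteq> 0" "cmod (\<zeta> * complex_of_real R) < \<rho>"
        using that(1) R by (auto simp: norm_mult)
      then show "G (J y + \<zeta> *s v) l \<noteq> 0" "G' (J y + \<zeta> *s v) l \<noteq> 0"
        using \<rho>(2) that(2) by (auto simp: v_def)
    qed
    define u where "u n = J (im_part (z (\<sigma> n)))" for n
    have "(((\<lambda>n. im_part (z n)) \<circ> s) \<circ> (\<lambda>n. r1 (r2 n))) \<longlonglongrightarrow> y"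
      using r1(1) r2(1) by (intro LIMSEQ_subseq_LIMSEQ[OF lim_y]) (simp add: strict_mono_def)
    then have "(\<lambda>n. im_part (z (\<sigma> n))) \<longlonglongrightarrow> y"
      by (simp add: o_def \<sigma>_def)
    then have u: "u \<longlonglongrightarrow> J y"
      unfolding u_def using cont_J by (intro continuous_on_tendsto_compose[of UNIV J]) auto
    obtain c where c: "c > 0" "\<forall>\<^sub>F n in sequentially. \<forall>l\<in>{..k}. \<forall>\<zeta>\<in>sphere 0 1.
        c \<le> cmod (proj_entry k (\<lambda>l. F n l (u n + \<zeta> *s v)) l l)"
      by (rule circle_lower_bound[OF \<Omega>(1) F(1) lim(1) u e(2) v(2) nz(1)])
    obtain c' where c': "c' > 0" "\<forall>\<^sub>F n in sequentially. \<forall>l\<in>{..k}. \<forall>\<zeta>\<in>sphere 0 1.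
        c' \<le> cmod (proj_entry k (\<lambda>l. F' n l (u n + \<zeta> *s v)) l l)"
      by (rule circle_lower_bound[OF \<Omega>(1) F(2) lim(2) u e(2) v(2) nz(2)])
    have "(\<lambda>n. 1 / real (Suc n)) \<longlonglongrightarrow> 0"
      using LIMSEQ_inverse_real_of_nat by (simp add: inverse_eq_divide)
    then have "((\<lambda>n. 1 / real (Suc n)) \<circ> \<sigma>) \<longlonglongrightarrow> 0"
      using \<sigma> by (rule LIMSEQ_subseq_LIMSEQ)
    then have "\<forall>\<^sub>F n in sequentially. 1 / real (Suc (\<sigma> n)) < min c c'"
      using c(1) c'(1) unfolding o_def by (intro order_tendstoD(2)) auto
    with c(2) c'(2) have "\<forall>\<^sub>F n in sequentially. good (1 / real (Suc (\<sigma> n))) (z (\<sigma> n)) v"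
    proof eventually_elim
      case (elim n)
      \<comment> \<open>The circle about the imaginary part, seen by the translated map, is the
        circle about the bad point, seen by the original map.\<close>
      have F_eq: "F n l (u n + \<zeta> *s v) = f l (z (\<sigma> n) + \<zeta> *s v)"
        "F' n l (u n + \<zeta> *s v) = f' l (z (\<sigma> n) + \<zeta> *s v)" for l \<zeta>
        using z_eq[of "\<sigma> n"] by (simp_all add: F_def F'_def u_def algebra_simps)
      have le: "1 / real (Suc (\<sigma> n)) \<le> c" "1 / real (Suc (\<sigma> n)) \<le> c'"
        using elim(3) by (simp_all add: min_less_iff_conj)
      show ?case
        unfolding good_def
      proof (intro conjI ballI)
        fix l \<zeta> assume "l \<in> {..k}" "\<zeta> \<in> sphere (0::complex) 1"
        then show "1 / real (Suc (\<sigma> n)) \<le> cmod (proj_entry k (\<lambda>l. f l (z (\<sigma> n) + \<zeta> *s v)) l l)"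
          "1 / real (Suc (\<sigma> n)) \<le> cmod (proj_entry k (\<lambda>l. f' l (z (\<sigma> n) + \<zeta> *s v)) l l)"
          using elim(1,2) le unfolding F_eq by (meson order_trans)+
      qed (rule v(1))
    qed
    then show False
      using z(2) by simp
  qed
  then show thesis
    using that unfolding good_def by blast
qed

text \<open>For \<open>q = |a l| / |a| \<le> 1\<close> the diagonal entry is \<open>q^2\<close>, and
  \<open>q^2 \<le> q\<close>. Settling for \<open>c \<le> q\<close> avoids a square root of
  \<open>c\<close>.\<close>

lemma component_lower_bound:
  assumes a: "0 < sqnorm k a" and "l \<le> k" and c: "c \<le> cmod (proj_entry k a l l)"
  shows "c * sqrt (sqnorm k a) \<le> cmod (a l)"
proof -
  let ?q = "cmod (a l) / sqrt (sqnorm k a)"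
  have "?q \<le> 1" "0 \<le> ?q"
    using cmod_le_sqrt_sqnorm[OF \<open>l \<le> k\<close>, of a] a by auto
  then have "?q * ?q \<le> ?q"
    using mult_left_le by blast
  moreover have "cmod (proj_entry k a l l) = ?q * ?q"
    using a by (simp add: proj_entry_def norm_divide norm_mult)
  ultimately have "c \<le> ?q"
    using c by linarith
  then show ?thesis
    using a by (simp add: field_simps)
qed

text \<open>Adding and subtracting one mixed term splits the wedge of the products into a wedge of
  \<open>b\<close>, \<open>b'\<close> and a wedge of \<open>a\<close>, \<open>a'\<close>. The norm
  of each of the four vectors is then replaced by one of its components at the cost of a factor
  \<open>1 / c\<close>, hence \<open>c ^ 4\<close>. The indices \<open>p\<close> and
  \<open>q\<close> may differ because two translates need not share a zero-free component.\<close>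

lemma product_wedge_bound:
  assumes pos: "0 < sqnorm k a" "0 < sqnorm k a'" "0 < sqnorm k b" "0 < sqnorm k b'"
    and \<eta>: "0 \<le> \<eta>"
    and closea: "\<And>i l. i \<le> k \<Longrightarrow> l \<le> k \<Longrightarrow> cmod (proj_entry k a i l - proj_entry k a' i l) \<le> \<eta>"
    and closeb: "\<And>i l. i \<le> k \<Longrightarrow> l \<le> k \<Longrightarrow> cmod (proj_entry k b i l - proj_entry k b' i l) \<le> \<eta>"
    and c: "0 < c"
    and lower: "c \<le> cmod (proj_entry k a p p)" "c \<le> cmod (proj_entry k b p p)"
      "c \<le> cmod (proj_entry k a' q q)" "c \<le> cmod (proj_entry k b' q q)"
    and idx: "i \<le> k" "l \<le> k" "p \<le> k" "q \<le> k"
  shows "cmod (a i * b i * (a' l * b' l) - a l * b l * (a' i * b' i)) \<le>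
    2 * real (Suc k) * \<eta> / c ^ 4 * cmod (a p * b p * (a' q * b' q))"
proof -
  define A A' B B' where "A = sqrt (sqnorm k a)" and "A' = sqrt (sqnorm k a')"
    and "B = sqrt (sqnorm k b)" and "B' = sqrt (sqnorm k b')"
  note defs = A_def A'_def B_def B'_def
  have nn: "0 \<le> A" "0 \<le> A'" "0 \<le> B" "0 \<le> B'"
    using pos by (auto simp: defs)
  have wa: "cmod (a i * a' l - a l * a' i) \<le> real (Suc k) * \<eta> * A * A'"
    and wb: "cmod (b i * b' l - b l * b' i) \<le> real (Suc k) * \<eta> * B * B'"
    unfolding defs using assms by (intro wedge_le_of_proj_entry; simp)+
  have up: "cmod (a i) \<le> A" "cmod (a' l) \<le> A'" "cmod (b l) \<le> B" "cmod (b' i) \<le> B'"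
    unfolding defs using idx by (auto intro: cmod_le_sqrt_sqnorm)
  have low: "c * A \<le> cmod (a p)" "c * A' \<le> cmod (a' q)" "c * B \<le> cmod (b p)" "c * B' \<le> cmod (b' q)"
    unfolding defs using pos idx lower by (auto intro: component_lower_bound)
  have "a i * b i * (a' l * b' l) - a l * b l * (a' i * b' i) =
      a i * a' l * (b i * b' l - b l * b' i) + b l * b' i * (a i * a' l - a l * a' i)"
    by (simp add: algebra_simps)
  then have "cmod (a i * b i * (a' l * b' l) - a l * b l * (a' i * b' i)) \<le>
      cmod (a i * a' l * (b i * b' l - b l * b' i)) + cmod (b l * b' i * (a i * a' l - a l * a' i))"
    using norm_triangle_ineq by simp
  also have "\<dots> \<le> A * A' * (real (Suc k) * \<eta> * B * B') + B * B' * (real (Suc k) * \<eta> * A * A')"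
    unfolding norm_mult using up wa wb nn by (intro add_mono mult_mono) auto
  also have "\<dots> = 2 * real (Suc k) * \<eta> / c ^ 4 * (c * A * (c * B) * (c * A' * (c * B')))"
    using c by (simp add: field_simps power4_eq_xxxx)
  also have "\<dots> \<le> 2 * real (Suc k) * \<eta> / c ^ 4 * (cmod (a p) * cmod (b p) * (cmod (a' q) * cmod (b' q)))"
    using low nn c \<eta> by (intro mult_left_mono mult_mono) auto
  finally show ?thesis
    by (simp add: norm_mult)
qed

section \<open>The wedge of two translates\<close>

text \<open>The estimates on \<open>f\<close> and \<open>f'\<close> are needed only on the circle;
  inside the disc their components may vanish. There it suffices that the disc stays in the tube and
  that \<open>g p\<close> at one translate and \<open>g q\<close> at the other have no
  zeros.\<close>

lemma divided_product_proj_entry_close: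
  fixes \<Omega> :: "(real ^ 'm) set"
  assumes hol: "hol_map_CP \<Omega> k f" "hol_map_CP \<Omega> k f'" "\<And>l. l \<le> k \<Longrightarrow> hol_on (tube \<Omega>) (g l)"
    and gh: "\<And>l z. l \<le> k \<Longrightarrow> z \<in> tube \<Omega> \<Longrightarrow> g l z * h z = f l z * f' l z"
    and disc: "\<And>\<zeta>. \<zeta> \<in> cball 0 1 \<Longrightarrow> z + \<zeta> *s v \<in> tube \<Omega>"
    and \<eta>: "0 \<le> \<eta>"
    and close: "\<And>\<zeta> i l. \<lbrakk>\<zeta> \<in> sphere 0 1; i \<le> k; l \<le> k\<rbrakk> \<Longrightarrow>
      cmod (proj_entry k (\<lambda>l. f l (z + \<zeta> *s v + real_to_complex s)) i l -
            proj_entry k (\<lambda>l. f l (z + \<zeta> *s v + real_to_complex t)) i l) \<le> \<eta>"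
      "\<And>\<zeta> i l. \<lbrakk>\<zeta> \<in> sphere 0 1; i \<le> k; l \<le> k\<rbrakk> \<Longrightarrow>
      cmod (proj_entry k (\<lambda>l. f' l (z + \<zeta> *s v + real_to_complex s)) i l -
            proj_entry k (\<lambda>l. f' l (z + \<zeta> *s v + real_to_complex t)) i l) \<le> \<eta>"
    and c: "0 < c"
    and lower: "\<And>\<zeta> l. \<lbrakk>\<zeta> \<in> sphere 0 1; l \<le> k\<rbrakk> \<Longrightarrow>
        c \<le> cmod (proj_entry k (\<lambda>l. f l (z + \<zeta> *s v + real_to_complex s)) l l)"
      "\<And>\<zeta> l. \<lbrakk>\<zeta> \<in> sphere 0 1; l \<le> k\<rbrakk> \<Longrightarrow>
        c \<le> cmod (proj_entry k (\<lambda>l. f' l (z + \<zeta> *s v + real_to_complex s)) l l)"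
      "\<And>\<zeta> l. \<lbrakk>\<zeta> \<in> sphere 0 1; l \<le> k\<rbrakk> \<Longrightarrow>
        c \<le> cmod (proj_entry k (\<lambda>l. f l (z + \<zeta> *s v + real_to_complex t)) l l)"
      "\<And>\<zeta> l. \<lbrakk>\<zeta> \<in> sphere 0 1; l \<le> k\<rbrakk> \<Longrightarrow>
        c \<le> cmod (proj_entry k (\<lambda>l. f' l (z + \<zeta> *s v + real_to_complex t)) l l)"
    and p: "p \<le> k" "\<And>\<zeta>. \<zeta> \<in> cball 0 1 \<Longrightarrow> g p (z + \<zeta> *s v + real_to_complex s) \<noteq> 0"
    and q: "q \<le> k" "\<And>\<zeta>. \<zeta> \<in> cball 0 1 \<Longrightarrow> g q (z + \<zeta> *s v + real_to_complex t) \<noteq> 0"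
    and il: "i \<le> k" "l \<le> k"
  shows "cmod (proj_entry k (\<lambda>l. g l (z + real_to_complex s)) i l -
      proj_entry k (\<lambda>l. g l (z + real_to_complex t)) i l) \<le>
    real (Suc k) * (2 * real (Suc k) * \<eta> / c ^ 4)"
proof -
  define \<kappa> where "\<kappa> = 2 * real (Suc k) * \<eta> / c ^ 4"
  define a where "a l \<zeta> = g l (z + \<zeta> *s v + real_to_complex s)" for l \<zeta>
  define b where "b l \<zeta> = g l (z + \<zeta> *s v + real_to_complex t)" for l \<zeta>
  have "0 \<le> \<kappa>"
    using \<eta> c by (simp add: \<kappa>_def)
  have hola: "a l holomorphic_on cball 0 1" and holb: "b l holomorphic_on cball 0 1" if "l \<le> k" for l
    unfolding a_def b_def by (intro hol_on_line[OF hol_on_translate[OF hol(3)[OF that]] disc]; simp)+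
  have wedge: "cmod (a i 0 * b l 0 - a l 0 * b i 0) \<le> \<kappa> * cmod (a p 0 * b q 0)"
    if il: "i \<le> k" "l \<le> k" for i l
  proof -
    \<comment> \<open>Dividing by a component of each translate makes the function insensitive to
      rescaling either coordinate tuple, which is why \<open>h\<close> cancels.\<close>
    define \<Theta> where "\<Theta> \<zeta> = (a i \<zeta> * b l \<zeta> - a l \<zeta> * b i \<zeta>) / (a p \<zeta> * b q \<zeta>)" for \<zeta>
    have nz: "a p \<zeta> * b q \<zeta> \<noteq> 0" if "\<zeta> \<in> cball 0 1" for \<zeta>
      using p(2)[OF that] q(2)[OF that] by (simp add: a_def b_def)
    have hol\<Theta>: "\<Theta> holomorphic_on cball 0 1"
      unfolding \<Theta>_def using il p(1) q(1) nz by (intro holomorphic_intros hola holb) auto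
    have boundary: "cmod (\<Theta> \<zeta>) \<le> \<kappa>" if \<zeta>: "\<zeta> \<in> frontier (cball 0 1)" for \<zeta>
    proof -
      define y where "y = z + \<zeta> *s v"
      define hs where "hs = h (y + real_to_complex s)"
      define ht where "ht = h (y + real_to_complex t)"
      have \<zeta>': "\<zeta> \<in> sphere 0 1" "\<zeta> \<in> cball 0 1"
        using \<zeta> by auto
      have y: "y \<in> tube \<Omega>"
        using disc[OF \<zeta>'(2)] by (simp add: y_def)
      have ah: "a j \<zeta> * hs = f j (y + real_to_complex s) * f' j (y + real_to_complex s)"
        and bh: "b j \<zeta> * ht = f j (y + real_to_complex t) * f' j (y + real_to_complex t)" if "j \<le> k" for j
        using gh[OF that] y by (simp_all add: a_def b_def hs_def ht_def y_def)
      \<comment> \<open>On the circle \<open>h\<close> has no zeros at either translate: its product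
        with \<open>g p\<close> or \<open>g q\<close> is a product of nonvanishing
        components.\<close>
      have "f p (y + real_to_complex s) \<noteq> 0" "f' p (y + real_to_complex s) \<noteq> 0"
        "f q (y + real_to_complex t) \<noteq> 0" "f' q (y + real_to_complex t) \<noteq> 0"
        using lower[OF \<zeta>'(1)] p(1) q(1) c by (fastforce simp: y_def proj_entry_def)+
      then have "hs * ht \<noteq> 0"
        using ah[OF p(1)] bh[OF q(1)] by auto
      \<comment> \<open>Multiplication by both values of \<open>h\<close> turns every component of
        \<open>g\<close> into a product of components of \<open>f\<close> and
        \<open>f'\<close>.\<close>
      have bound: "cmod (a i \<zeta> * hs * (b l \<zeta> * ht) - a l \<zeta> * hs * (b i \<zeta> * ht)) \<le>
          \<kappa> * cmod (a p \<zeta> * hs * (b q \<zeta> * ht))"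
        unfolding ah[OF il(1)] ah[OF il(2)] ah[OF p(1)] bh[OF il(1)] bh[OF il(2)] bh[OF q(1)] \<kappa>_def
        using y hol close lower \<zeta>'(1) il p(1) q(1) c \<eta> unfolding y_def
        by (intro product_wedge_bound[where a = "\<lambda>l. f l (z + \<zeta> *s v + real_to_complex s)"
              and a' = "\<lambda>l. f l (z + \<zeta> *s v + real_to_complex t)"
              and b = "\<lambda>l. f' l (z + \<zeta> *s v + real_to_complex s)"
              and b' = "\<lambda>l. f' l (z + \<zeta> *s v + real_to_complex t)"])
          (auto intro: hol_map_CP_sqnorm_pos)
      have factor: "a i \<zeta> * hs * (b l \<zeta> * ht) - a l \<zeta> * hs * (b i \<zeta> * ht) =
          (a i \<zeta> * b l \<zeta> - a l \<zeta> * b i \<zeta>) * (hs * ht)"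
        "a p \<zeta> * hs * (b q \<zeta> * ht) = a p \<zeta> * b q \<zeta> * (hs * ht)"
        by (simp_all add: algebra_simps)
      have "cmod (a i \<zeta> * b l \<zeta> - a l \<zeta> * b i \<zeta>) * cmod (hs * ht) \<le>
          \<kappa> * cmod (a p \<zeta> * b q \<zeta>) * cmod (hs * ht)"
        using bound unfolding factor by (simp only: norm_mult mult.assoc)
      then have "cmod (a i \<zeta> * b l \<zeta> - a l \<zeta> * b i \<zeta>) \<le> \<kappa> * cmod (a p \<zeta> * b q \<zeta>)"
        by (rule mult_right_le_imp_le) (use \<open>hs * ht \<noteq> 0\<close> in simp)
      moreover have "0 < cmod (a p \<zeta> * b q \<zeta>)"
        using nz[OF \<zeta>'(2)] by simp
      ultimately show ?thesis
        unfolding \<Theta>_def norm_divide by (simp only: pos_divide_le_eq)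
    qed
    have "cmod (\<Theta> 0) \<le> \<kappa>"
    proof (rule maximum_modulus_frontier[OF _ _ bounded_cball boundary])
      show "\<Theta> holomorphic_on interior (cball 0 1)"
        using hol\<Theta> interior_subset by (rule holomorphic_on_subset)
      show "continuous_on (closure (cball 0 1)) \<Theta>"
        using holomorphic_on_imp_continuous_on[OF hol\<Theta>] by simp
    qed simp_all
    moreover have "0 < cmod (a p 0 * b q 0)"
      using nz[of 0] by simp
    ultimately show ?thesis
      unfolding \<Theta>_def norm_divide by (simp only: pos_divide_le_eq)
  qed
  define A where "A l = g l (z + real_to_complex s)" for l
  define B where "B l = g l (z + real_to_complex t)" for l
  have AB: "a l 0 = A l" "b l 0 = B l" for l
    by (simp_all add: a_def b_def A_def B_def)
  have "A p \<noteq> 0" "B q \<noteq> 0"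
    using p(2)[of 0] q(2)[of 0] by (simp_all add: A_def B_def)
  then have pos: "0 < sqnorm k A" "0 < sqnorm k B"
    using p(1) q(1) by (auto intro: sqnorm_pos)
  \<comment> \<open>Components are at most the norm, so \<open>p\<close> and \<open>q\<close>
    disappear from the bound.\<close>
  have "cmod (A i * B l - A l * B i) \<le> \<kappa> * sqrt (sqnorm k A) * sqrt (sqnorm k B)"
    if "i \<le> k" "l \<le> k" for i l
  proof -
    have "cmod (A i * B l - A l * B i) \<le> \<kappa> * (cmod (A p) * cmod (B q))"
      using wedge[OF that] by (simp add: AB norm_mult)
    also have "\<dots> \<le> \<kappa> * (sqrt (sqnorm k A) * sqrt (sqnorm k B))"
      using p(1) q(1) \<open>0 \<le> \<kappa>\<close> pos by (intro mult_left_mono mult_mono cmod_le_sqrt_sqnorm) auto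
    finally show ?thesis
      by (simp add: mult.assoc)
  qed
  then have "cmod (proj_entry k A i l - proj_entry k B i l) \<le> real (Suc k) * \<kappa>"
    using il by (intro proj_entry_le_of_wedge[OF pos \<open>0 \<le> \<kappa>\<close>])
  then show ?thesis
    by (simp add: A_def[abs_def] B_def[abs_def] \<kappa>_def)
qed

lemma exists_index_outside:
  assumes "card {l. l \<le> k \<and> P l} \<le> k"
  obtains l :: nat where "l \<le> k" "\<not> P l"
proof -
  have "{l. l \<le> k \<and> P l} \<noteq> {..k}"
    using assms by auto
  then show thesis
    using that by blast
qed

section \<open>Almost periodicity of the divided product\<close>

theorem theorem6p2:
  fixes \<Omega> :: "(real ^ 'm) set" and k :: nat
    and f ft g :: "nat \<Rightarrow> complex ^ 'm \<Rightarrow> complex" and h :: "complex ^ 'm \<Rightarrow> complex"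
  assumes "domain \<Omega>" and "convex \<Omega>"
    and "almost_periodic_CP \<Omega> k f" and "almost_periodic_CP \<Omega> k ft"
    and "hol_on (tube \<Omega>) h"
    and "\<forall>l\<le>k. hol_on (tube \<Omega>) (g l) \<and> (\<forall>z\<in>tube \<Omega>. g l z * h z = f l z * ft l z)"
    and "\<forall>\<Omega>'. compactly_in \<Omega>' \<Omega> \<longrightarrow> (\<exists>\<delta>>0. \<forall>z0\<in>tube \<Omega>'.
           card {l. l \<le> k \<and> ball z0 \<delta> \<inter> {z\<in>tube \<Omega>. g l z = 0} \<noteq> {}} \<le> k)"
  shows "almost_periodic_CP \<Omega> k g"
proof -
  have \<Omega>: "open \<Omega>" "\<Omega> \<noteq> {}"
    using assms(1) by (auto simp: domain_def)
  have f: "hol_map_CP \<Omega> k f" and ft: "hol_map_CP \<Omega> k ft"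
    using assms(3,4) by (auto simp: almost_periodic_CP_def)
  have g: "hol_on (tube \<Omega>) (g l)" "z \<in> tube \<Omega> \<Longrightarrow> g l z * h z = f l z * ft l z" if "l \<le> k" for l z
    using assms(6) that by auto
  have zero_free: "\<exists>l\<le>k. \<forall>w\<in>ball z \<delta> \<inter> tube \<Omega>. g l w \<noteq> 0"
    if "card {l. l \<le> k \<and> ball z \<delta> \<inter> {z\<in>tube \<Omega>. g l z = 0} \<noteq> {}} \<le> k" for z \<delta>
    using that by (rule exists_index_outside) blast
  have hol_g: "hol_map_CP \<Omega> k g"
    unfolding hol_map_CP_def
  proof (intro conjI allI impI ballI)
    show "hol_on (tube \<Omega>) (g l)" if "l \<le> k" for l
      using g that by blast
    show "\<exists>z\<in>tube \<Omega>. g l z \<noteq> 0" if l: "l \<le> k" for l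
    proof -
      obtain w w' where w: "w \<in> tube \<Omega>" "f l w \<noteq> 0" and w': "w' \<in> tube \<Omega>" "ft l w' \<noteq> 0"
        using f ft l unfolding hol_map_CP_def by blast
      \<comment> \<open>A product of two nonzero functions must be shown not to vanish identically:
        the dense set where \<open>f l\<close> is nonzero meets the open set where
        \<open>ft l\<close> is, and at a common point \<open>g l * h\<close> is nonzero.\<close>
      have "w' \<in> closure {z \<in> tube \<Omega>. f l z \<noteq> 0}"
        using dense_nonzero_component[OF \<Omega>(1) assms(2) f CP_limit_const[OF f] l w] w'(1) by blast
      moreover have "open {z \<in> tube \<Omega>. ft l z \<noteq> 0}"
        using open_nonzero_component[OF \<Omega>(1) ft CP_limit_const[OF ft] l] .
      ultimately obtain z where "z \<in> tube \<Omega>" "f l z \<noteq> 0" "ft l z \<noteq> 0"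
        using w' open_Int_closure_eq_empty[of "{z \<in> tube \<Omega>. ft l z \<noteq> 0}" "{z \<in> tube \<Omega>. f l z \<noteq> 0}"] by blast
      then show ?thesis
        using g(2)[OF l, of z] by (intro bexI[of _ z]) auto
    qed
    show "\<exists>l\<le>k. g l z \<noteq> 0" if z: "z \<in> tube \<Omega>" for z
    proof -
      have "compactly_in {im_part z} \<Omega>"
        using z by (simp add: compactly_in_def tube_def)
      then obtain \<delta> where "\<delta> > 0" "\<forall>z0\<in>tube {im_part z}.
          card {l. l \<le> k \<and> ball z0 \<delta> \<inter> {z\<in>tube \<Omega>. g l z = 0} \<noteq> {}} \<le> k"
        using assms(7) by blast
      moreover have "z \<in> tube {im_part z}"
        by (simp add: tube_def)
      ultimately have "card {l. l \<le> k \<and> ball z \<delta> \<inter> {z\<in>tube \<Omega>. g l z = 0} \<noteq> {}} \<le> k"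
        by blast
      from zero_free[OF this] show ?thesis
        using z \<open>\<delta> > 0\<close> by auto
    qed
  qed
  have "\<exists>r G. strict_mono r \<and> CP_limit \<Omega> k (\<lambda>n l z. g l (z + real_to_complex (t (r n)))) G"
    for t :: "nat \<Rightarrow> real ^ 'm"
  proof -
    obtain r1 G where r1: "strict_mono r1" "CP_limit \<Omega> k (\<lambda>n l z. f l (z + real_to_complex (t (r1 n)))) G"
      using assms(3)[unfolded almost_periodic_CP_iff, THEN conjunct2, rule_format, of t] by blast
    obtain r2 Gt where r2: "strict_mono r2"
      "CP_limit \<Omega> k (\<lambda>n l z. ft l (z + real_to_complex (t (r1 (r2 n))))) Gt"
      using assms(4)[unfolded almost_periodic_CP_iff, THEN conjunct2, rule_format, of "\<lambda>n. t (r1 n)"]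
      by blast
    define \<tau> where "\<tau> n = t (r1 (r2 n))" for n
    have lim: "CP_limit \<Omega> k (\<lambda>n l z. f l (z + real_to_complex (\<tau> n))) G"
      "CP_limit \<Omega> k (\<lambda>n l z. ft l (z + real_to_complex (\<tau> n))) Gt"
      using CP_limit_subseq[OF r1(2) r2(1)] r2(2) by (simp_all add: \<tau>_def)
    have cauchy: "uniformly_Cauchy_on (tube \<Omega>') (\<lambda>n z. proj_entry k (\<lambda>l. g l (z + real_to_complex (\<tau> n))) i l)"
      if \<Omega>': "compactly_in \<Omega>' \<Omega>" and il: "i \<le> k" "l \<le> k" for \<Omega>' i l
    proof (rule uniformly_Cauchy_onI)
      fix e :: real assume "e > 0"
      obtain d \<Omega>'' where d: "d > 0" and \<Omega>'': "compactly_in \<Omega>'' \<Omega>"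
        and thick: "\<And>z w. z \<in> tube \<Omega>' \<Longrightarrow> norm w \<le> d \<Longrightarrow> z + w \<in> tube \<Omega>''"
        using compactly_in_enlarge[OF \<Omega>(1) \<Omega>'] by metis
      obtain \<delta> where \<delta>: "\<delta> > 0" "\<And>z. z \<in> tube \<Omega>' \<Longrightarrow>
          card {l. l \<le> k \<and> ball z \<delta> \<inter> {z\<in>tube \<Omega>. g l z = 0} \<noteq> {}} \<le> k"
        using assms(7) \<Omega>' by blast
      \<comment> \<open>Radii below \<open>d\<close> keep the discs in the enlarged tube; radii
        below \<open>\<delta>\<close> keep them in a ball on which some component of
        \<open>g\<close> has no zeros.\<close>
      obtain c where c: "c > 0" and circles: "\<And>z. z \<in> tube \<Omega>' \<Longrightarrow> \<exists>v. norm v < min d \<delta> \<and>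
          (\<forall>l\<in>{..k}. \<forall>\<zeta>\<in>sphere 0 1. c \<le> cmod (proj_entry k (\<lambda>l. f l (z + \<zeta> *s v)) l l) \<and>
            c \<le> cmod (proj_entry k (\<lambda>l. ft l (z + \<zeta> *s v)) l l))"
        using uniform_circles[OF \<Omega>(1) assms(2) \<Omega>(2) assms(3,4) \<Omega>', of "min d \<delta>"] d \<delta>(1)
        by (metis min_less_iff_conj)
      \<comment> \<open>The factor of the disc estimate, with \<open>c / 2\<close> as the lower
        bound on the circle.\<close>
      define K where "K = 2 * (real (Suc k))\<^sup>2 / (c / 2) ^ 4"
      have "K > 0"
        using c by (simp add: K_def)
      \<comment> \<open>The first term limits the loss of the lower bound between translates to
        \<open>c / 2\<close>; the 2 in the second makes the final inequality strict.\<close>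
      define \<eta> where "\<eta> = min (c / 2) (e / (2 * K))"
      have \<eta>: "\<eta> > 0" "\<eta> \<le> c / 2" "K * \<eta> < e"
      proof -
        show "\<eta> > 0" "\<eta> \<le> c / 2"
          using c \<open>e > 0\<close> \<open>K > 0\<close> by (auto simp: \<eta>_def)
        have "K * \<eta> \<le> K * (e / (2 * K))"
          using \<open>K > 0\<close> by (intro mult_left_mono) (auto simp: \<eta>_def)
        then show "K * \<eta> < e"
          using \<open>K > 0\<close> \<open>e > 0\<close> by simp
      qed
      obtain N1 where N1: "\<And>m n z i l. \<lbrakk>m \<ge> N1; n \<ge> N1; z \<in> tube \<Omega>''; i \<le> k; l \<le> k\<rbrakk> \<Longrightarrow>
          cmod (proj_entry k (\<lambda>l. f l (z + real_to_complex (\<tau> m))) i l -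
            proj_entry k (\<lambda>l. f l (z + real_to_complex (\<tau> n))) i l) \<le> \<eta>"
        using CP_limit_Cauchy[OF lim(1) \<Omega>'' \<eta>(1)] by blast
      obtain N2 where N2: "\<And>m n z i l. \<lbrakk>m \<ge> N2; n \<ge> N2; z \<in> tube \<Omega>''; i \<le> k; l \<le> k\<rbrakk> \<Longrightarrow>
          cmod (proj_entry k (\<lambda>l. ft l (z + real_to_complex (\<tau> m))) i l -
            proj_entry k (\<lambda>l. ft l (z + real_to_complex (\<tau> n))) i l) \<le> \<eta>"
        using CP_limit_Cauchy[OF lim(2) \<Omega>'' \<eta>(1)] by blast
      define N where "N = max N1 N2"
      have "dist (proj_entry k (\<lambda>l. g l (z + real_to_complex (\<tau> m))) i l)
          (proj_entry k (\<lambda>l. g l (z + real_to_complex (\<tau> n))) i l) < e"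
        if z: "z \<in> tube \<Omega>'" and mn: "m \<ge> N" "n \<ge> N" for z m n
      proof -
        \<comment> \<open>The circle is chosen once, at the translate by \<open>\<tau> N\<close>,
          and serves all later translates; separate choices for \<open>m\<close> and
          \<open>n\<close> could give different circles.\<close>
        obtain v where v: "norm v < d" "norm v < \<delta>"
          and circ: "\<And>l \<zeta>. \<lbrakk>l \<le> k; \<zeta> \<in> sphere 0 1\<rbrakk> \<Longrightarrow>
            c \<le> cmod (proj_entry k (\<lambda>l. f l (z + \<zeta> *s v + real_to_complex (\<tau> N))) l l) \<and>
            c \<le> cmod (proj_entry k (\<lambda>l. ft l (z + \<zeta> *s v + real_to_complex (\<tau> N))) l l)"
          using circles[of "z + real_to_complex (\<tau> N)"] z by (auto simp: add_ac)
        have small: "norm (\<zeta> *s v) \<le> norm v" if "\<zeta> \<in> cball 0 1" for \<zeta>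
          using that by (simp add: norm_vector_smult mult_left_le_one_le)
        have disc: "z + \<zeta> *s v \<in> tube \<Omega>''" if "\<zeta> \<in> cball 0 1" for \<zeta>
          using thick[OF z, of "\<zeta> *s v"] small[OF that] v by simp
        have disc': "z + \<zeta> *s v \<in> tube \<Omega>" if "\<zeta> \<in> cball 0 1" for \<zeta>
          using disc[OF that] tube_mono[OF compactly_in_subset[OF \<Omega>'']] by blast
        \<comment> \<open>From \<open>N\<close> on, the diagonal entries on the circle differ from
          those at \<open>\<tau> N\<close> by at most \<open>\<eta> \<le> c / 2\<close>.\<close>
        have lower: "c / 2 \<le> cmod (proj_entry k (\<lambda>l. f l (z + \<zeta> *s v + real_to_complex (\<tau> j))) l l)"
          "c / 2 \<le> cmod (proj_entry k (\<lambda>l. ft l (z + \<zeta> *s v + real_to_complex (\<tau> j))) l l)"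
          if "\<zeta> \<in> sphere 0 1" "l \<le> k" "j \<ge> N" for \<zeta> l j
          using circ[OF that(2,1)] N1[of N j "z + \<zeta> *s v" l l] N2[of N j "z + \<zeta> *s v" l l] disc[of \<zeta>] that \<eta>(2)
            norm_triangle_ineq2[of "proj_entry k (\<lambda>l. f l (z + \<zeta> *s v + real_to_complex (\<tau> N))) l l"
              "proj_entry k (\<lambda>l. f l (z + \<zeta> *s v + real_to_complex (\<tau> j))) l l"]
            norm_triangle_ineq2[of "proj_entry k (\<lambda>l. ft l (z + \<zeta> *s v + real_to_complex (\<tau> N))) l l"
              "proj_entry k (\<lambda>l. ft l (z + \<zeta> *s v + real_to_complex (\<tau> j))) l l"]
          by (auto simp: N_def)
        \<comment> \<open>The divisor hypothesis is applied at the translated centre, which lies in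
          the same tube; the index obtained depends on \<open>j\<close>.\<close>
        have "\<exists>p\<le>k. \<forall>\<zeta>\<in>cball 0 1. g p (z + \<zeta> *s v + real_to_complex (\<tau> j)) \<noteq> 0" for j
        proof -
          obtain p where "p \<le> k" and p: "\<And>w. w \<in> ball (z + real_to_complex (\<tau> j)) \<delta> \<Longrightarrow> w \<in> tube \<Omega> \<Longrightarrow> g p w \<noteq> 0"
            using zero_free[OF \<delta>(2)] z by (metis IntI tube_translate)
          have "g p (z + \<zeta> *s v + real_to_complex (\<tau> j)) \<noteq> 0" if "\<zeta> \<in> cball 0 1" for \<zeta>
          proof (rule p)
            show "z + \<zeta> *s v + real_to_complex (\<tau> j) \<in> ball (z + real_to_complex (\<tau> j)) \<delta>"
              using small[OF that] v by (simp add: dist_norm)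
          qed (use disc'[OF that] in simp)
          then show ?thesis
            using \<open>p \<le> k\<close> by blast
        qed
        then obtain p q where p: "p \<le> k" "\<And>\<zeta>. \<zeta> \<in> cball 0 1 \<Longrightarrow> g p (z + \<zeta> *s v + real_to_complex (\<tau> m)) \<noteq> 0"
          and q: "q \<le> k" "\<And>\<zeta>. \<zeta> \<in> cball 0 1 \<Longrightarrow> g q (z + \<zeta> *s v + real_to_complex (\<tau> n)) \<noteq> 0"
          by metis
        have "cmod (proj_entry k (\<lambda>l. g l (z + real_to_complex (\<tau> m))) i l -
            proj_entry k (\<lambda>l. g l (z + real_to_complex (\<tau> n))) i l) \<le>
          real (Suc k) * (2 * real (Suc k) * \<eta> / (c / 2) ^ 4)"
        proof (rule divided_product_proj_entry_close[OF f ft g disc' _ _ _ _ _ _ _ _ p q il])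
          fix \<zeta> :: complex and i l assume "\<zeta> \<in> sphere 0 1" and il: "i \<le> k" "l \<le> k"
          then have "z + \<zeta> *s v \<in> tube \<Omega>''"
            by (intro disc) auto
          then show "cmod (proj_entry k (\<lambda>l. f l (z + \<zeta> *s v + real_to_complex (\<tau> m))) i l -
              proj_entry k (\<lambda>l. f l (z + \<zeta> *s v + real_to_complex (\<tau> n))) i l) \<le> \<eta>"
            "cmod (proj_entry k (\<lambda>l. ft l (z + \<zeta> *s v + real_to_complex (\<tau> m))) i l -
              proj_entry k (\<lambda>l. ft l (z + \<zeta> *s v + real_to_complex (\<tau> n))) i l) \<le> \<eta>"
            using mn il by (auto intro: N1 N2 simp: N_def)
        qed (use \<eta>(1) c lower mn in auto)
        also have "\<dots> = K * \<eta>"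
          by (simp add: K_def power2_eq_square)
        finally show ?thesis
          using \<eta>(3) by (simp add: dist_norm)
      qed
      then show "\<exists>M. \<forall>z\<in>tube \<Omega>'. \<forall>m\<ge>M. \<forall>n\<ge>M. dist (proj_entry k (\<lambda>l. g l (z + real_to_complex (\<tau> m))) i l)
          (proj_entry k (\<lambda>l. g l (z + real_to_complex (\<tau> n))) i l) < e"
        by blast
    qed
    have pos: "0 < sqnorm k (\<lambda>l. g l (z + real_to_complex (\<tau> n)))" if "z \<in> tube \<Omega>" for z n
      using hol_map_CP_sqnorm_pos[OF hol_map_CP_translate[OF hol_g] that] .
    obtain H where "CP_limit \<Omega> k (\<lambda>n l z. g l (z + real_to_complex (\<tau> n))) H"
      by (rule exists_CP_limit_of_uniformly_Cauchy[OF pos cauchy])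
    moreover have "strict_mono (\<lambda>n. r1 (r2 n))"
      using r1(1) r2(1) by (simp add: strict_mono_def)
    ultimately show ?thesis
      unfolding \<tau>_def by blast
  qed
  then show ?thesis
    using hol_g by (simp add: almost_periodic_CP_iff)
qed

end
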